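(* Let $M$ be an isometrically immersed $n$-dimensional submanifold of codimension $r$ of an $(n+r)$-dimensional locally metallic Riemannian manifold $(\bar M,J,g)$ with $J^2=pJ+qI$, let $\Sigma:=(T,g,\eta_\alpha,\xi_\alpha,(a_{\alpha\beta}))_{1\le\alpha,\beta\le r}$ be the induced structure on $M$, and suppose that $M$ is slant with slant angle $\theta$. Then $$(\nabla_XT^2)Y=p\cos^2(\theta)\sum_{\alpha=1}^r[\eta_\alpha(Y)A_{N_\alpha}X+h_\alpha(X,Y)\xi_\alpha]$$ for any $X,Y\in\Gamma(TM)$. Moreover, if $T^2$ is Codazzi, then on $M$: $$\sum_{\alpha=1}^r(\eta_\alpha\otimes A_{N_\alpha}-A_{N_\alpha}\otimes\eta_\alpha)=0.$$
   Context: A metallic Riemannian manifold $(\bar M,J,g)$ is a smooth manifold with a $(1,1)$-tensor field $J$ satisfying $J^2=pJ+qI$ for some positive integers $p,q$ and a Riemannian metric $g$ with $g(JX,Y)=g(X,JY)$ for all vector fields $X,Y$. It is locally metallic if $\bar\nabla J=0$, where $\bar\nabla$ is the Levi-Civita connection of $(\bar M,g)$. $\nabla$ is the Levi-Civita connection of the induced metric on $M$, $\{N_1,\dots,N_r\}$ a (local) orthonormal frame of the normal bundle; $h_\alpha$ (symmetric) and $A_{N_\alpha}$ are defined by $\bar\nabla_XY=\nabla_XY+\sum_\alpha h_\alpha(X,Y)N_\alpha$ and $g(A_{N_\alpha}X,Y)=h_\alpha(X,Y)$. The induced structure $\Sigma$ is defined by $JX=TX+\sum_\alpha\eta_\alpha(X)N_\alpha$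 for $X\in\Gamma(TM)$ and $JN_\alpha=\xi_\alpha+\sum_\beta a_{\alpha\beta}N_\beta$, with $TX,\xi_\alpha$ tangent to $M$. $M$ is slant if for all $x\in M$ and nonzero $X_x\in T_xM$ the angle $\theta(X_x)\in[0,\pi/2]$ between $JX_x$ and $T_xM$ is a constant $\theta$, called the slant angle; $\cos\theta(X_x)=\|TX_x\|/\|JX_x\|$. For a $(1,1)$-tensor field $S$ on $M$, $(\nabla_XS)Y:=\nabla_X(SY)-S(\nabla_XY)$, and $S$ is Codazzi if $(\nabla_XS)Y=(\nabla_YS)X$ for all $X,Y\in\Gamma(TM)$. $(\eta_\alpha\otimes A_{N_\alpha})(X,Y)=\eta_\alpha(X)A_{N_\alpha}Y$ and $(A_{N_\alpha}\otimes\eta_\alpha)(X,Y)=\eta_\alpha(Y)A_{N_\alpha}X$. *)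

theory Defs
  imports "HOL-Analysis.Analysis"
begin

section \<open>Smooth maps on open subsets of Euclidean spaces\<close>

primrec Ck_on :: "nat \<Rightarrow> 'a::euclidean_space set \<Rightarrow> ('a \<Rightarrow> 'b::real_normed_vector) \<Rightarrow> bool" where
  "Ck_on 0 S f \<longleftrightarrow> continuous_on S f"
| "Ck_on (Suc k) S f \<longleftrightarrow> (\<forall>x\<in>S. f differentiable (at x)) \<and>
     (\<forall>v. Ck_on k S (\<lambda>x. frechet_derivative f (at x) v))"

text \<open>This is only used for open sets \<open>S\<close>.\<close>
definition smooth_on :: "'a::euclidean_space set \<Rightarrow> ('a \<Rightarrow> 'b::real_normed_vector) \<Rightarrow> bool" where
  "smooth_on S f \<longleftrightarrow> (\<forall>k. Ck_on k S f)"

section \<open>Smooth manifolds\<close>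

text \<open>
  The point set of a manifold is a whole (Hausdorff, second countable) topological type \<open>'m\<close>;
  the model space is a Euclidean space \<open>'a\<close>, so that the dimension is \<open>DIM('a)\<close>.
  A chart is a pair of its domain and its coordinate map.
\<close>
type_synonym ('m, 'a) chart = "'m set \<times> ('m \<Rightarrow> 'a)"

abbreviation chart_dom :: "('m, 'a) chart \<Rightarrow> 'm set" where "chart_dom \<equiv> fst"
abbreviation chart_map :: "('m, 'a) chart \<Rightarrow> 'm \<Rightarrow> 'a" where "chart_map \<equiv> snd"

definition chart_inv :: "('m, 'a) chart \<Rightarrow> 'a \<Rightarrow> 'm" where
  "chart_inv c = inv_into (chart_dom c) (chart_map c)"

definition is_chart :: "('m::topological_space, 'a::euclidean_space) chart \<Rightarrow> bool" where
  "is_chart c \<longleftrightarrow> open (chart_dom c) \<and> open (chart_map c ` chart_dom c) \<and>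
     homeomorphism (chart_dom c) (chart_map c ` chart_dom c) (chart_map c) (chart_inv c)"

definition smooth_atlas ::
  "('m::{t2_space,second_countable_topology}, 'a::euclidean_space) chart set \<Rightarrow> bool" where
  "smooth_atlas A \<longleftrightarrow> (\<forall>c\<in>A. is_chart c) \<and> (\<Union>c\<in>A. chart_dom c) = UNIV \<and>
     (\<forall>c\<in>A. \<forall>d\<in>A. smooth_on (chart_map c ` (chart_dom c \<inter> chart_dom d)) (chart_map d \<circ> chart_inv c))"

text \<open>
  A chart around each point is chosen once and for all, and every tangent space is identified
  with the model space \<open>'a\<close> through the differential of the chart chosen at its base point.
  So a vector field is a function \<open>'m \<Rightarrow> 'a\<close>, a (1,1)-tensor field is a function
  \<open>'m \<Rightarrow> 'a \<Rightarrow> 'a\<close>, and so on. Smoothness is never tested in the chosen charts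
  (which jump from point to point) but in the coordinates of one fixed chart,
  see \<open>tcoord\<close> below.
\<close>
definition chart_at :: "('m, 'a) chart set \<Rightarrow> 'm \<Rightarrow> ('m, 'a) chart" where
  "chart_at A x = (SOME c. c \<in> A \<and> x \<in> chart_dom c)"

text \<open>Components, with respect to a chart \<open>d\<close> around \<open>x\<close>, of the tangent vector \<open>v\<close> at \<open>x\<close>.\<close>
definition tcoord ::
  "('m, 'a::euclidean_space) chart set \<Rightarrow> ('m, 'a) chart \<Rightarrow> 'm \<Rightarrow> 'a \<Rightarrow> 'a" where
  "tcoord A d x v =
     frechet_derivative (chart_map d \<circ> chart_inv (chart_at A x)) (at (chart_map (chart_at A x) x)) v"

definition smooth_fun ::
  "('m, 'a::euclidean_space) chart set \<Rightarrow> 'm set \<Rightarrow> ('m \<Rightarrow> real) \<Rightarrow> bool" where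
  "smooth_fun A W h \<longleftrightarrow> (\<forall>c\<in>A. smooth_on (chart_map c ` (W \<inter> chart_dom c)) (h \<circ> chart_inv c))"

text \<open>The derivative \<open>v h\<close> of a function \<open>h\<close> along a tangent vector \<open>v\<close> at \<open>x\<close>.\<close>
definition dfun ::
  "('m, 'a::euclidean_space) chart set \<Rightarrow> ('m \<Rightarrow> real) \<Rightarrow> 'm \<Rightarrow> 'a \<Rightarrow> real" where
  "dfun A h x v = frechet_derivative (h \<circ> chart_inv (chart_at A x)) (at (chart_map (chart_at A x) x)) v"

definition smooth_map ::
  "('m::topological_space, 'a::euclidean_space) chart set \<Rightarrow>
   ('n::topological_space, 'b::euclidean_space) chart set \<Rightarrow> ('m \<Rightarrow> 'n) \<Rightarrow> bool" where
  "smooth_map A B f \<longleftrightarrow> continuous_on UNIV f \<and>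
     (\<forall>c\<in>A. \<forall>d\<in>B. smooth_on (chart_map c ` (chart_dom c \<inter> f -` chart_dom d))
                            (chart_map d \<circ> f \<circ> chart_inv c))"

text \<open>The differential of \<open>f\<close> at \<open>x\<close>, from the tangent space at \<open>x\<close> to the one at \<open>f x\<close>.\<close>
definition dmap ::
  "('m, 'a::euclidean_space) chart set \<Rightarrow> ('n, 'b::euclidean_space) chart set \<Rightarrow> ('m \<Rightarrow> 'n) \<Rightarrow>
   'm \<Rightarrow> 'a \<Rightarrow> 'b" where
  "dmap A B f x v =
     frechet_derivative (chart_map (chart_at B (f x)) \<circ> f \<circ> chart_inv (chart_at A x))
       (at (chart_map (chart_at A x) x)) v"

section \<open>Vector fields and tensor fields\<close>

text \<open>
  \<open>smooth_field_along A B f W V\<close>: the restriction of \<open>V\<close> to the open set \<open>W\<close> is a smooth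
  vector field along the map \<open>f\<close>, i.e. a smooth section over \<open>W\<close> of the pull-back by \<open>f\<close>
  of the tangent bundle of the target, \<open>V x\<close> being a tangent vector at \<open>f x\<close>.
\<close>
definition smooth_field_along ::
  "('m, 'a::euclidean_space) chart set \<Rightarrow> ('n, 'b::euclidean_space) chart set \<Rightarrow> ('m \<Rightarrow> 'n) \<Rightarrow>
   'm set \<Rightarrow> ('m \<Rightarrow> 'b) \<Rightarrow> bool" where
  "smooth_field_along A B f W V \<longleftrightarrow>
     (\<forall>c\<in>A. \<forall>d\<in>B. smooth_on (chart_map c ` (W \<inter> chart_dom c \<inter> f -` chart_dom d))
        (\<lambda>z. tcoord B d (f (chart_inv c z)) (V (chart_inv c z))))"

definition smooth_vf ::
  "('m, 'a::euclidean_space) chart set \<Rightarrow> 'm set \<Rightarrow> ('m \<Rightarrow> 'a) \<Rightarrow> bool" where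
  "smooth_vf A W X \<longleftrightarrow> smooth_field_along A A (\<lambda>x. x) W X"

definition riemannian_metric ::
  "('m::topological_space, 'a::euclidean_space) chart set \<Rightarrow> ('m \<Rightarrow> 'a \<Rightarrow> 'a \<Rightarrow> real) \<Rightarrow> bool" where
  "riemannian_metric A g \<longleftrightarrow>
     (\<forall>x. bilinear (g x) \<and> (\<forall>u v. g x u v = g x v u) \<and> (\<forall>v. v \<noteq> 0 \<longrightarrow> g x v v > 0)) \<and>
     (\<forall>W X Y. open W \<and> smooth_vf A W X \<and> smooth_vf A W Y \<longrightarrow> smooth_fun A W (\<lambda>x. g x (X x) (Y x)))"

definition gnorm :: "('m \<Rightarrow> 'a \<Rightarrow> 'a \<Rightarrow> real) \<Rightarrow> 'm \<Rightarrow> 'a \<Rightarrow> real" where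
  "gnorm g x v = sqrt (g x v v)"

definition tensor_field_11 ::
  "('m::topological_space, 'a::euclidean_space) chart set \<Rightarrow> ('m \<Rightarrow> 'a \<Rightarrow> 'a) \<Rightarrow> bool" where
  "tensor_field_11 A S \<longleftrightarrow> (\<forall>x. linear (S x)) \<and>
     (\<forall>W X. open W \<and> smooth_vf A W X \<longrightarrow> smooth_vf A W (\<lambda>x. S x (X x)))"

section \<open>Connections\<close>

text \<open>
  \<open>D x v V\<close> is the covariant derivative at the point \<open>x\<close>, in the direction of the tangent
  vector \<open>v\<close> at \<open>x\<close>, of a field \<open>V\<close> that is smooth on some neighbourhood of \<open>x\<close>. As usual,
  covariant derivatives are taken of local sections (e.g. of local frames), so the axioms are
  required on every open set \<open>W\<close>; values on fields that are not smooth near \<open>x\<close> are irrelevant.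
  The general notion is that of a connection in the pull-back of the tangent bundle of the
  target by \<open>f\<close>; a connection on the manifold itself is the case of the identity map.
\<close>
type_synonym ('m, 'a, 'b) connection = "'m \<Rightarrow> 'a \<Rightarrow> ('m \<Rightarrow> 'b) \<Rightarrow> 'b"

definition connection_along ::
  "('m::topological_space, 'a::euclidean_space) chart set \<Rightarrow>
   ('n::topological_space, 'b::euclidean_space) chart set \<Rightarrow> ('m \<Rightarrow> 'n) \<Rightarrow>
   ('m, 'a, 'b) connection \<Rightarrow> bool" where
  "connection_along A B f D \<longleftrightarrow>
     (\<forall>W V. open W \<and> smooth_field_along A B f W V \<longrightarrow>
        (\<forall>x\<in>W. linear (\<lambda>v. D x v V)) \<and>
        (\<forall>X. smooth_vf A W X \<longrightarrow> smooth_field_along A B f W (\<lambda>x. D x (X x) V)) \<and>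
        (\<forall>V'. smooth_field_along A B f W V' \<longrightarrow>
           (\<forall>x\<in>W. \<forall>v. D x v (\<lambda>y. V y + V' y) = D x v V + D x v V')) \<and>
        (\<forall>h. smooth_fun A W h \<longrightarrow>
           (\<forall>x\<in>W. \<forall>v. D x v (\<lambda>y. h y *\<^sub>R V y) = dfun A h x v *\<^sub>R V x + h x *\<^sub>R D x v V)))"

definition affine_connection ::
  "('m::topological_space, 'a::euclidean_space) chart set \<Rightarrow> ('m, 'a, 'a) connection \<Rightarrow> bool" where
  "affine_connection A D \<longleftrightarrow> connection_along A A (\<lambda>x. x) D"

text \<open>
  Torsion-freeness, \<open>\<nabla>_X Y - \<nabla>_Y X = [X,Y]\<close>, is stated through the defining property
  \<open>[X,Y] h = X (Y h) - Y (X h)\<close> of the Lie bracket.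
\<close>
definition torsion_free ::
  "('m::topological_space, 'a::euclidean_space) chart set \<Rightarrow> ('m, 'a, 'a) connection \<Rightarrow> bool" where
  "torsion_free A D \<longleftrightarrow>
     (\<forall>W X Y h. open W \<and> smooth_vf A W X \<and> smooth_vf A W Y \<and> smooth_fun A W h \<longrightarrow>
        (\<forall>x\<in>W. dfun A h x (D x (X x) Y - D x (Y x) X) =
           dfun A (\<lambda>y. dfun A h y (Y y)) x (X x) - dfun A (\<lambda>y. dfun A h y (X y)) x (Y x)))"

definition metric_compatible ::
  "('m::topological_space, 'a::euclidean_space) chart set \<Rightarrow> ('m \<Rightarrow> 'a \<Rightarrow> 'a \<Rightarrow> real) \<Rightarrow>
   ('m, 'a, 'a) connection \<Rightarrow> bool" where
  "metric_compatible A g D \<longleftrightarrow>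
     (\<forall>W Y Z. open W \<and> smooth_vf A W Y \<and> smooth_vf A W Z \<longrightarrow>
        (\<forall>x\<in>W. \<forall>v. dfun A (\<lambda>y. g y (Y y) (Z y)) x v = g x (D x v Y) (Z x) + g x (Y x) (D x v Z)))"

definition levi_civita ::
  "('m::topological_space, 'a::euclidean_space) chart set \<Rightarrow> ('m \<Rightarrow> 'a \<Rightarrow> 'a \<Rightarrow> real) \<Rightarrow>
   ('m, 'a, 'a) connection \<Rightarrow> bool" where
  "levi_civita A g D \<longleftrightarrow> affine_connection A D \<and> torsion_free A D \<and> metric_compatible A g D"

text \<open>
  The connection \<open>Df\<close> induced by \<open>D\<close> on vector fields along \<open>f\<close>. It gives the meaning of
  \<open>\<nabla>_X V\<close> for the ambient connection when \<open>X\<close> is tangent to the submanifold and \<open>V\<close> is only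
  defined along the submanifold.
\<close>
definition pullback_connection ::
  "('m::topological_space, 'a::euclidean_space) chart set \<Rightarrow>
   ('n::topological_space, 'b::euclidean_space) chart set \<Rightarrow> ('m \<Rightarrow> 'n) \<Rightarrow>
   ('n, 'b, 'b) connection \<Rightarrow> ('m, 'a, 'b) connection \<Rightarrow> bool" where
  "pullback_connection A B f D Df \<longleftrightarrow> connection_along A B f Df \<and>
     (\<forall>W Z. open W \<and> smooth_vf B W Z \<longrightarrow>
        (\<forall>x v. f x \<in> W \<longrightarrow> Df x v (\<lambda>y. Z (f y)) = D (f x) (dmap A B f x v) Z))"

text \<open>\<open>(\<nabla>_X S) Y = \<nabla>_X (S Y) - S (\<nabla>_X Y)\<close> at the point \<open>x\<close>.\<close>
definition nabla_tensor ::
  "('m, 'a, 'a::real_vector) connection \<Rightarrow> ('m \<Rightarrow> 'a \<Rightarrow> 'a) \<Rightarrow> ('m \<Rightarrow> 'a) \<Rightarrow> ('m \<Rightarrow> 'a) \<Rightarrow> 'm \<Rightarrow> 'a" where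
  "nabla_tensor D S X Y x = D x (X x) (\<lambda>y. S y (Y y)) - S x (D x (X x) Y)"

definition codazzi ::
  "('m, 'a::euclidean_space) chart set \<Rightarrow> ('m, 'a, 'a) connection \<Rightarrow> ('m \<Rightarrow> 'a \<Rightarrow> 'a) \<Rightarrow> bool" where
  "codazzi A D S \<longleftrightarrow>
     (\<forall>X Y x. smooth_vf A UNIV X \<and> smooth_vf A UNIV Y \<longrightarrow>
        nabla_tensor D S X Y x = nabla_tensor D S Y X x)"

section \<open>Metallic Riemannian manifolds\<close>

definition metallic_riemannian ::
  "('n::{t2_space,second_countable_topology}, 'b::euclidean_space) chart set \<Rightarrow>
   ('n \<Rightarrow> 'b \<Rightarrow> 'b) \<Rightarrow> ('n \<Rightarrow> 'b \<Rightarrow> 'b \<Rightarrow> real) \<Rightarrow> nat \<Rightarrow> nat \<Rightarrow> bool" where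
  "metallic_riemannian B J g p q \<longleftrightarrow>
     smooth_atlas B \<and> riemannian_metric B g \<and> tensor_field_11 B J \<and> p > 0 \<and> q > 0 \<and>
     (\<forall>y v. J y (J y v) = real p *\<^sub>R J y v + real q *\<^sub>R v) \<and>
     (\<forall>y u v. g y (J y u) v = g y u (J y v))"

text \<open>\<open>D\<close> is the Levi-Civita connection of \<open>g\<close>.\<close>
definition locally_metallic ::
  "('n::{t2_space,second_countable_topology}, 'b::euclidean_space) chart set \<Rightarrow>
   ('n \<Rightarrow> 'b \<Rightarrow> 'b) \<Rightarrow> ('n \<Rightarrow> 'b \<Rightarrow> 'b \<Rightarrow> real) \<Rightarrow> nat \<Rightarrow> nat \<Rightarrow> ('n, 'b, 'b) connection \<Rightarrow> bool" where
  "locally_metallic B J g p q D \<longleftrightarrow>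
     metallic_riemannian B J g p q \<and> levi_civita B g D \<and>
     (\<forall>W X Y. open W \<and> smooth_vf B W X \<and> smooth_vf B W Y \<longrightarrow> (\<forall>y\<in>W. nabla_tensor D J X Y y = 0))"

section \<open>Isometric immersions and the induced structure\<close>

definition isometric_immersion ::
  "('m::topological_space, 'a::euclidean_space) chart set \<Rightarrow>
   ('n::topological_space, 'b::euclidean_space) chart set \<Rightarrow>
   ('m \<Rightarrow> 'a \<Rightarrow> 'a \<Rightarrow> real) \<Rightarrow> ('n \<Rightarrow> 'b \<Rightarrow> 'b \<Rightarrow> real) \<Rightarrow> ('m \<Rightarrow> 'n) \<Rightarrow> bool" where
  "isometric_immersion A B g gbar f \<longleftrightarrow> smooth_map A B f \<and>
     (\<forall>x. inj (dmap A B f x)) \<and>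
     (\<forall>x u v. g x u v = gbar (f x) (dmap A B f x u) (dmap A B f x v))"

definition normal_space ::
  "('m, 'a::euclidean_space) chart set \<Rightarrow> ('n, 'b::euclidean_space) chart set \<Rightarrow>
   ('n \<Rightarrow> 'b \<Rightarrow> 'b \<Rightarrow> real) \<Rightarrow> ('m \<Rightarrow> 'n) \<Rightarrow> 'm \<Rightarrow> 'b set" where
  "normal_space A B gbar f x = {w. \<forall>v. gbar (f x) w (dmap A B f x v) = 0}"

text \<open>
  A local frame over \<open>U\<close>; when \<open>r\<close> is the codimension, \<open>r\<close> orthonormal normal
  vectors form a basis of the normal space.
\<close>
definition orthonormal_normal_frame ::
  "('m, 'a::euclidean_space) chart set \<Rightarrow> ('n, 'b::euclidean_space) chart set \<Rightarrow>
   ('n \<Rightarrow> 'b \<Rightarrow> 'b \<Rightarrow> real) \<Rightarrow> ('m \<Rightarrow> 'n) \<Rightarrow> 'm set \<Rightarrow> nat \<Rightarrow> (nat \<Rightarrow> 'm \<Rightarrow> 'b) \<Rightarrow> bool" where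
  "orthonormal_normal_frame A B gbar f U r N \<longleftrightarrow>
     (\<forall>\<alpha>\<in>{1..r}. smooth_field_along A B f U (N \<alpha>) \<and> (\<forall>x\<in>U. N \<alpha> x \<in> normal_space A B gbar f x)) \<and>
     (\<forall>x\<in>U. \<forall>\<alpha>\<in>{1..r}. \<forall>\<beta>\<in>{1..r}. gbar (f x) (N \<alpha> x) (N \<beta> x) = (if \<alpha> = \<beta> then 1 else 0))"

text \<open>
  \<open>T\<close> is defined on the whole submanifold by the frame-independent decomposition of \<open>JX\<close> into
  its tangential part \<open>TX\<close> and a normal part; the other components refer to the frame \<open>N\<close> over \<open>U\<close>.
\<close>
definition induced_structure ::
  "('m, 'a::euclidean_space) chart set \<Rightarrow> ('n, 'b::euclidean_space) chart set \<Rightarrow>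
   ('n \<Rightarrow> 'b \<Rightarrow> 'b \<Rightarrow> real) \<Rightarrow> ('m \<Rightarrow> 'n) \<Rightarrow> ('n \<Rightarrow> 'b \<Rightarrow> 'b) \<Rightarrow> 'm set \<Rightarrow> nat \<Rightarrow> (nat \<Rightarrow> 'm \<Rightarrow> 'b) \<Rightarrow>
   ('m \<Rightarrow> 'a \<Rightarrow> 'a) \<Rightarrow> (nat \<Rightarrow> 'm \<Rightarrow> 'a \<Rightarrow> real) \<Rightarrow> (nat \<Rightarrow> 'm \<Rightarrow> 'a) \<Rightarrow> (nat \<Rightarrow> nat \<Rightarrow> 'm \<Rightarrow> real) \<Rightarrow> bool"
  where
  "induced_structure A B gbar f J U r N T \<eta> \<xi> a \<longleftrightarrow>
     (\<forall>x v. J (f x) (dmap A B f x v) - dmap A B f x (T x v) \<in> normal_space A B gbar f x) \<and>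
     (\<forall>x\<in>U. \<forall>v. J (f x) (dmap A B f x v) =
        dmap A B f x (T x v) + (\<Sum>\<alpha>=1..r. \<eta> \<alpha> x v *\<^sub>R N \<alpha> x)) \<and>
     (\<forall>x\<in>U. \<forall>\<alpha>\<in>{1..r}. J (f x) (N \<alpha> x) =
        dmap A B f x (\<xi> \<alpha> x) + (\<Sum>\<beta>=1..r. a \<alpha> \<beta> x *\<^sub>R N \<beta> x))"

text \<open>
  The Gauss formula over \<open>U\<close>, which determines the second fundamental forms \<open>h \<alpha>\<close>; \<open>Df\<close> is the
  ambient connection along \<open>f\<close>, and \<open>D\<close> the connection of the submanifold.
\<close>
definition second_fundamental_forms ::
  "('m::topological_space, 'a::euclidean_space) chart set \<Rightarrow> ('n, 'b::euclidean_space) chart set \<Rightarrow>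
   ('m \<Rightarrow> 'n) \<Rightarrow> ('m, 'a, 'a) connection \<Rightarrow> ('m, 'a, 'b) connection \<Rightarrow>
   'm set \<Rightarrow> nat \<Rightarrow> (nat \<Rightarrow> 'm \<Rightarrow> 'b) \<Rightarrow> (nat \<Rightarrow> 'm \<Rightarrow> 'a \<Rightarrow> 'a \<Rightarrow> real) \<Rightarrow> bool" where
  "second_fundamental_forms A B f D Df U r N h \<longleftrightarrow>
     (\<forall>W X Y. open W \<and> W \<subseteq> U \<and> smooth_vf A W X \<and> smooth_vf A W Y \<longrightarrow>
        (\<forall>x\<in>W. Df x (X x) (\<lambda>y. dmap A B f y (Y y)) =
           dmap A B f x (D x (X x) Y) + (\<Sum>\<alpha>=1..r. h \<alpha> x (X x) (Y x) *\<^sub>R N \<alpha> x)))"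

definition shape_operators ::
  "('m \<Rightarrow> 'a \<Rightarrow> 'a \<Rightarrow> real) \<Rightarrow> 'm set \<Rightarrow> nat \<Rightarrow> (nat \<Rightarrow> 'm \<Rightarrow> 'a \<Rightarrow> 'a \<Rightarrow> real) \<Rightarrow>
   (nat \<Rightarrow> 'm \<Rightarrow> 'a \<Rightarrow> 'a) \<Rightarrow> bool" where
  "shape_operators g U r h AN \<longleftrightarrow>
     (\<forall>x\<in>U. \<forall>\<alpha>\<in>{1..r}. \<forall>u v. g x (AN \<alpha> x u) v = h \<alpha> x u v)"

text \<open>
  The angle between \<open>J v\<close> and the tangent space at \<open>x\<close>, for a nonzero tangent vector \<open>v\<close>
  whose image \<open>J v\<close> has tangential part \<open>T v\<close>.
\<close>
definition slant_angle_at ::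
  "('m, 'a::euclidean_space) chart set \<Rightarrow> ('n, 'b::euclidean_space) chart set \<Rightarrow>
   ('m \<Rightarrow> 'a \<Rightarrow> 'a \<Rightarrow> real) \<Rightarrow> ('n \<Rightarrow> 'b \<Rightarrow> 'b \<Rightarrow> real) \<Rightarrow> ('m \<Rightarrow> 'n) \<Rightarrow> ('n \<Rightarrow> 'b \<Rightarrow> 'b) \<Rightarrow>
   ('m \<Rightarrow> 'a \<Rightarrow> 'a) \<Rightarrow> 'm \<Rightarrow> 'a \<Rightarrow> real" where
  "slant_angle_at A B g gbar f J T x v =
     arccos (gnorm g x (T x v) / gnorm gbar (f x) (J (f x) (dmap A B f x v)))"

definition slant ::
  "('m, 'a::euclidean_space) chart set \<Rightarrow> ('n, 'b::euclidean_space) chart set \<Rightarrow>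
   ('m \<Rightarrow> 'a \<Rightarrow> 'a \<Rightarrow> real) \<Rightarrow> ('n \<Rightarrow> 'b \<Rightarrow> 'b \<Rightarrow> real) \<Rightarrow> ('m \<Rightarrow> 'n) \<Rightarrow> ('n \<Rightarrow> 'b \<Rightarrow> 'b) \<Rightarrow>
   ('m \<Rightarrow> 'a \<Rightarrow> 'a) \<Rightarrow> real \<Rightarrow> bool" where
  "slant A B g gbar f J T \<theta> \<longleftrightarrow> (\<forall>x v. v \<noteq> 0 \<longrightarrow> slant_angle_at A B g gbar f J T x v = \<theta>)"

text \<open>Values at \<open>x\<close> of \<open>\<eta> \<otimes> S\<close> and \<open>S \<otimes> \<eta>\<close> for a 1-form \<open>\<eta>\<close> and a (1,1)-tensor field \<open>S\<close>.\<close>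
definition form_tensor ::
  "('m \<Rightarrow> 'a \<Rightarrow> real) \<Rightarrow> ('m \<Rightarrow> 'a \<Rightarrow> 'a::real_vector) \<Rightarrow> 'm \<Rightarrow> 'a \<Rightarrow> 'a \<Rightarrow> 'a" where
  "form_tensor \<eta> S x u v = \<eta> x u *\<^sub>R S x v"

definition tensor_form ::
  "('m \<Rightarrow> 'a \<Rightarrow> 'a::real_vector) \<Rightarrow> ('m \<Rightarrow> 'a \<Rightarrow> real) \<Rightarrow> 'm \<Rightarrow> 'a \<Rightarrow> 'a \<Rightarrow> 'a" where
  "tensor_form S \<eta> x u v = \<eta> x v *\<^sub>R S x u"

end

theory Submission
  imports Defs
begin

text \<open>
  The first formula combines two facts. For every submanifold of a locally metallic manifold,
  \<open>(\<nabla>\<^sub>X T) Y = \<Sum>\<^sub>\<alpha> (\<eta>\<^sub>\<alpha>(Y) A\<^sub>\<alpha> X + h\<^sub>\<alpha>(X,Y) \<xi>\<^sub>\<alpha>)\<close>: this is the tangential part of the derivative of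
  \<open>J Y = T Y + \<Sum> \<eta>\<^sub>\<alpha>(Y) N\<^sub>\<alpha>\<close>, in which \<open>J\<close> is parallel and the formulas of Gauss and Weingarten are used
  (lemma \<open>nabla_T\<close>). If the submanifold is slant, then \<open>g(T v, T v) = cos\<^sup>2\<theta> g(J v, J v)\<close>, and polarizing with
  \<open>J\<^sup>2 = pJ + qI\<close> gives \<open>T\<^sup>2 = cos\<^sup>2\<theta> (pT + qI)\<close> (lemma \<open>slant_T_square\<close>), hence
  \<open>\<nabla>T\<^sup>2 = p cos\<^sup>2\<theta> \<nabla>T\<close>.

  For the second part, alternate the formula for \<open>\<nabla>T\<close> in \<open>X\<close> and \<open>Y\<close>. The terms with \<open>h\<^sub>\<alpha>\<close> cancel by symmetry,
  so the asserted identity says that \<open>T\<close> itself is Codazzi. If \<open>cos \<theta> \<noteq> 0\<close> this follows from the Codazzi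
  condition on \<open>T\<^sup>2\<close>; if \<open>cos \<theta> = 0\<close> then \<open>T = 0\<close>.

  Most of the work lies in the facts that are usually taken for granted here. The connection \<open>Df\<close> along the
  immersion \<open>f\<close> is specified only by its product rule and by its values on ambient vector fields composed with \<open>f\<close>. The
  product rule makes it local (lemma \<open>connection_cong\<close>); that it is compatible with the metric, torsion-free and satisfies
  \<open>Df J = 0\<close> is then derived by expanding fields along \<open>f\<close> in a coordinate frame of the ambient manifold (lemmas
  \<open>pullback_metric_compatible\<close>, \<open>pullback_torsion_free\<close>, \<open>pullback_parallel_tensor\<close>); torsion-freeness gives the symmetry of \<open>h\<^sub>\<alpha>\<close>. The
  smoothness of \<open>T Y\<close>, without which its covariant derivative has no meaning, follows from that of its inner products
  with tangent fields by Gram-Schmidt elimination (lemma \<open>smooth_vf_in_span\<close>).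
\<close>

section \<open>Smooth maps between Euclidean spaces\<close>

lemma frechet_derivative_eqI:
  "(f has_derivative f') (at x) \<Longrightarrow> frechet_derivative f (at x) = f'"
  by (metis frechet_derivative_at)

lemma differentiable_has_frechet:
  "f differentiable (at x) \<Longrightarrow> (f has_derivative frechet_derivative f (at x)) (at x)"
  by (simp add: frechet_derivative_works)

lemma has_derivative_cong_open:
  assumes "open S" "x \<in> S" "\<And>y. y \<in> S \<Longrightarrow> f y = g y"
  shows "(f has_derivative f') (at x) \<longleftrightarrow> (g has_derivative f') (at x)"
proof
  show "(g has_derivative f') (at x)" if "(f has_derivative f') (at x)"
    by (rule has_derivative_transform_within_open[OF that assms])
  show "(f has_derivative f') (at x)" if "(g has_derivative f') (at x)"
    by (rule has_derivative_transform_within_open[OF that assms(1,2)]) (simp add: assms(3))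
qed

lemma frechet_derivative_cong_open:
  assumes "open S" "x \<in> S" "\<And>y. y \<in> S \<Longrightarrow> f y = g y"
  shows "frechet_derivative f (at x) = frechet_derivative g (at x)"
    and "f differentiable (at x) \<longleftrightarrow> g differentiable (at x)"
  using has_derivative_cong_open[OF assms]
  by (simp_all add: frechet_derivative_def differentiable_def)

lemma Ck_on_subset: "Ck_on k S f \<Longrightarrow> R \<subseteq> S \<Longrightarrow> Ck_on k R f"
  by (induction k arbitrary: f) (auto intro: continuous_on_subset)

lemma Ck_on_Suc_directional:
  "Ck_on (Suc k) S f \<Longrightarrow> Ck_on k S (\<lambda>x. frechet_derivative f (at x) v)"
  by simp

text \<open>
  The derivatives in \<^const>\<open>Ck_on\<close> are taken at points of the whole space, so only on an open set
  is regularity determined by the values there.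
\<close>
lemma Ck_on_cong:
  assumes "open S"
  shows "Ck_on k S f \<Longrightarrow> (\<And>x. x \<in> S \<Longrightarrow> f x = g x) \<Longrightarrow> Ck_on k S g"
proof (induction k arbitrary: f g)
  case 0
  then show ?case by (simp cong: continuous_on_cong)
next
  case (Suc k)
  have eq: "frechet_derivative f (at x) = frechet_derivative g (at x)"
      "f differentiable (at x) \<longleftrightarrow> g differentiable (at x)" if "x \<in> S" for x
    using frechet_derivative_cong_open[OF assms that] Suc.prems(2) by blast+
  have "Ck_on k S (\<lambda>x. frechet_derivative g (at x) v)" for v
    by (rule Suc.IH[OF Ck_on_Suc_directional[OF Suc.prems(1)]]) (simp add: eq)
  then show ?case using Suc.prems(1) eq by auto
qed

text \<open>
  The form in which all closure properties are shown: it suffices to exhibit some derivative whose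
  directional values are \<open>k\<close> times differentiable.
\<close>
lemma Ck_on_SucI:
  assumes "open S" "\<And>x. x \<in> S \<Longrightarrow> (f has_derivative f' x) (at x)"
    and "\<And>v. Ck_on k S (\<lambda>x. f' x v)"
  shows "Ck_on (Suc k) S f"
proof -
  have "Ck_on k S (\<lambda>x. frechet_derivative f (at x) v)" for v
    by (rule Ck_on_cong[OF assms(1) assms(3)]) (simp add: frechet_derivative_eqI[OF assms(2)])
  then show ?thesis using assms(2) by (auto simp: differentiable_def)
qed

lemma Ck_on_SucD: "Ck_on (Suc k) S f \<Longrightarrow> Ck_on k S f"
proof (induction k arbitrary: f)
  case 0
  then show ?case
    by (auto intro!: continuous_at_imp_continuous_on differentiable_imp_continuous_within)
next
  case (Suc k)
  then show ?case by simp
qed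

lemma Ck_on_Suc_has_derivative:
  "Ck_on (Suc k) S f \<Longrightarrow> x \<in> S \<Longrightarrow> (f has_derivative frechet_derivative f (at x)) (at x)"
  by (simp add: differentiable_has_frechet)

lemma Ck_on_const: "open S \<Longrightarrow> Ck_on k S (\<lambda>x. c)"
  by (induction k arbitrary: c) (auto intro!: Ck_on_SucI[where f' = "\<lambda>x v. 0"] simp del: Ck_on.simps(2))

lemma Ck_on_add: "open S \<Longrightarrow> Ck_on k S f \<Longrightarrow> Ck_on k S g \<Longrightarrow> Ck_on k S (\<lambda>x. f x + g x)"
proof (induction k arbitrary: f g)
  case 0
  then show ?case by (simp add: continuous_on_add)
next
  case (Suc k)
  show ?case
    by (rule Ck_on_SucI[OF Suc.prems(1) has_derivative_add
          [OF Ck_on_Suc_has_derivative[OF Suc.prems(2)] Ck_on_Suc_has_derivative[OF Suc.prems(3)]]])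
       (auto intro!: Suc.IH Suc.prems(1) Ck_on_Suc_directional[OF Suc.prems(2)]
          Ck_on_Suc_directional[OF Suc.prems(3)])
qed

lemma Ck_on_bilinear:
  assumes "open S" "bounded_bilinear m"
  shows "Ck_on k S f \<Longrightarrow> Ck_on k S g \<Longrightarrow> Ck_on k S (\<lambda>x. m (f x) (g x))"
proof (induction k arbitrary: f g)
  case 0
  then show ?case using assms(2) by (simp add: bounded_bilinear.continuous_on)
next
  case (Suc k)
  show ?case
    by (rule Ck_on_SucI[OF assms(1) bounded_bilinear.FDERIV[OF assms(2)
          Ck_on_Suc_has_derivative[OF Suc.prems(1)] Ck_on_Suc_has_derivative[OF Suc.prems(2)]]])
       (auto intro!: Suc.IH Ck_on_add assms(1) Ck_on_SucD[OF Suc.prems(1)] Ck_on_SucD[OF Suc.prems(2)]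
          Ck_on_Suc_directional[OF Suc.prems(1)] Ck_on_Suc_directional[OF Suc.prems(2)])
qed

lemma Ck_on_bounded_linear:
  assumes "open S" "bounded_linear L"
  shows "Ck_on k S f \<Longrightarrow> Ck_on k S (\<lambda>x. L (f x))"
proof (induction k arbitrary: f)
  case 0
  then show ?case using assms(2) by (simp add: bounded_linear.continuous_on)
next
  case (Suc k)
  show ?case
    by (rule Ck_on_SucI[OF assms(1) bounded_linear.has_derivative[OF assms(2)
          Ck_on_Suc_has_derivative[OF Suc.prems(1)]]])
       (auto intro!: Suc.IH Ck_on_Suc_directional[OF Suc.prems(1)])
qed

lemma Ck_on_sum:
  assumes "open S" "\<And>i. i \<in> I \<Longrightarrow> Ck_on k S (f i)"
  shows "Ck_on k S (\<lambda>x. \<Sum>i\<in>I. f i x)"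
  using assms(2)
  by (induction I rule: infinite_finite_induct) (auto intro!: Ck_on_add Ck_on_const assms(1))

text \<open>
  The derivative \<open>- f' / f^2\<close> contains \<open>1/f\<close> once more, so the induction is on the order \<open>k\<close>: one
  order of differentiability of \<open>1/f\<close> pays for the next.
\<close>
lemma Ck_on_inverse:
  fixes f :: "'a::euclidean_space \<Rightarrow> real"
  assumes "open S" "\<And>x. x \<in> S \<Longrightarrow> f x \<noteq> 0"
  shows "Ck_on k S f \<Longrightarrow> Ck_on k S (\<lambda>x. inverse (f x))"
proof (induction k)
  case 0
  then show ?case using assms by (simp add: continuous_on_inverse)
next
  case (Suc k)
  note mult = Ck_on_bilinear[OF assms(1) bounded_bilinear_mult]
  have inv: "Ck_on k S (\<lambda>x. inverse (f x))"
    using Suc Ck_on_SucD by blast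
  show ?case
  proof (rule Ck_on_SucI[OF assms(1)])
    show "((\<lambda>x. inverse (f x)) has_derivative
        (\<lambda>v. (- 1) * (inverse (f x) * frechet_derivative f (at x) v * inverse (f x)))) (at x)"
      if "x \<in> S" for x
      using Deriv.has_derivative_inverse[OF assms(2) Ck_on_Suc_has_derivative[OF Suc.prems]] that
      by simp
    show "Ck_on k S (\<lambda>x. (- 1) * (inverse (f x) * frechet_derivative f (at x) v * inverse (f x)))" for v
      by (intro mult inv Ck_on_const assms(1) Ck_on_Suc_directional[OF Suc.prems])
  qed
qed

lemma linear_eq_sum_Basis:
  fixes L :: "'a::euclidean_space \<Rightarrow> 'b::real_vector"
  assumes "linear L"
  shows "L v = (\<Sum>b\<in>Basis. (v \<bullet> b) *\<^sub>R L b)"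
proof -
  have "L v = L (\<Sum>b\<in>Basis. (v \<bullet> b) *\<^sub>R b)"
    by (simp add: euclidean_representation)
  then show ?thesis
    by (simp add: linear_sum[OF assms] linear_cmul[OF assms])
qed

text \<open>
  In the chain rule the outer derivative is applied to a vector that varies with the point. Expanding
  that vector in the standard basis leaves only directional derivatives of \<open>g\<close> in fixed directions,
  to which the induction hypothesis (for all \<open>g\<close>) applies.
\<close>
lemma Ck_on_compose:
  fixes f :: "'a::euclidean_space \<Rightarrow> 'b::euclidean_space" and g :: "'b \<Rightarrow> 'c::real_normed_vector"
  assumes "open S" "open R" "f ` S \<subseteq> R"
  shows "Ck_on k S f \<Longrightarrow> Ck_on k R g \<Longrightarrow> Ck_on k S (\<lambda>x. g (f x))"
proof (induction k arbitrary: g)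
  case 0
  then show ?case using continuous_on_compose2[of R g S f] assms by simp
next
  case (Suc k)
  have dg: "(g has_derivative frechet_derivative g (at (f x))) (at (f x))" if "x \<in> S" for x
    using Ck_on_Suc_has_derivative[OF Suc.prems(2)] that assms(3) by blast
  have fk: "Ck_on k S f"
    using Suc.prems(1) by (rule Ck_on_SucD)
  show ?case
  proof (rule Ck_on_SucI[OF assms(1)])
    show "((\<lambda>x. g (f x)) has_derivative (\<lambda>v. \<Sum>b\<in>Basis. (frechet_derivative f (at x) v \<bullet> b) *\<^sub>R
        frechet_derivative g (at (f x)) b)) (at x)" if "x \<in> S" for x
      using has_derivative_compose[OF Ck_on_Suc_has_derivative[OF Suc.prems(1) that] dg[OF that]]
      by (subst (asm) linear_eq_sum_Basis[OF has_derivative_linear[OF dg[OF that]]])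
    show "Ck_on k S (\<lambda>x. \<Sum>b\<in>Basis. (frechet_derivative f (at x) v \<bullet> b) *\<^sub>R
        frechet_derivative g (at (f x)) b)" for v
      by (intro Ck_on_sum assms(1) Ck_on_bilinear[OF assms(1) bounded_bilinear_scaleR] 
           Ck_on_bounded_linear[OF assms(1) bounded_linear_inner_left] 
           Ck_on_Suc_directional[OF Suc.prems(1)]
           Suc.IH[OF fk] Ck_on_Suc_directional[OF Suc.prems(2)])
  qed
qed

text \<open>
  Needed because smoothness on a manifold is required in whole chart domains, whereas constructions with
  local frames give it only near each point.
\<close>
lemma Ck_on_local:
  assumes "\<And>x. x \<in> S \<Longrightarrow> \<exists>R. open R \<and> x \<in> R \<and> Ck_on k R f"
  shows "Ck_on k S f"
  using assms
proof (induction k arbitrary: f)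
  case 0
  have "isCont f x" if "x \<in> S" for x
    using 0[OF that] continuous_on_eq_continuous_at by auto
  then show ?case by (simp add: continuous_at_imp_continuous_on)
next
  case (Suc k)
  have "Ck_on k S (\<lambda>x. frechet_derivative f (at x) v)" for v
  proof (rule Suc.IH)
    fix x assume "x \<in> S"
    then obtain R where "open R" "x \<in> R" "Ck_on (Suc k) R f" using Suc.prems by blast
    then show "\<exists>R. open R \<and> x \<in> R \<and> Ck_on k R (\<lambda>x. frechet_derivative f (at x) v)"
      using Ck_on_Suc_directional by blast
  qed
  moreover have "f differentiable (at x)" if "x \<in> S" for x
    using Suc.prems[OF that] by auto
  ultimately show ?case by simp
qed

lemma smooth_on_subset: "smooth_on S f \<Longrightarrow> R \<subseteq> S \<Longrightarrow> smooth_on R f"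
  by (auto simp: smooth_on_def intro: Ck_on_subset)

lemma smooth_on_cong: "open S \<Longrightarrow> smooth_on S f \<Longrightarrow> (\<And>x. x \<in> S \<Longrightarrow> f x = g x) \<Longrightarrow> smooth_on S g"
  by (auto simp: smooth_on_def intro: Ck_on_cong)

lemma smooth_on_local:
  "(\<And>x. x \<in> S \<Longrightarrow> \<exists>R. open R \<and> x \<in> R \<and> smooth_on R f) \<Longrightarrow> smooth_on S f"
  unfolding smooth_on_def by (intro allI Ck_on_local) meson

lemma smooth_on_const: "open S \<Longrightarrow> smooth_on S (\<lambda>x. c)"
  by (auto simp: smooth_on_def intro: Ck_on_const)

lemma smooth_on_add: "open S \<Longrightarrow> smooth_on S f \<Longrightarrow> smooth_on S g \<Longrightarrow> smooth_on S (\<lambda>x. f x + g x)"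
  by (auto simp: smooth_on_def intro: Ck_on_add)

lemma smooth_on_scaleR:
  "open S \<Longrightarrow> smooth_on S f \<Longrightarrow> smooth_on S g \<Longrightarrow> smooth_on S (\<lambda>x. f x *\<^sub>R g x)"
  by (auto simp: smooth_on_def intro: Ck_on_bilinear[OF _ bounded_bilinear_scaleR])

lemma smooth_on_inner_const: "open S \<Longrightarrow> smooth_on S f \<Longrightarrow> smooth_on S (\<lambda>x. f x \<bullet> b)"
  by (auto simp: smooth_on_def intro: Ck_on_bounded_linear[OF _ bounded_linear_inner_left])

lemma smooth_on_sum:
  "open S \<Longrightarrow> (\<And>i. i \<in> I \<Longrightarrow> smooth_on S (f i)) \<Longrightarrow> smooth_on S (\<lambda>x. \<Sum>i\<in>I. f i x)"
  by (auto simp: smooth_on_def intro: Ck_on_sum)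

lemma smooth_on_inverse:
  fixes f :: "'a::euclidean_space \<Rightarrow> real"
  shows "open S \<Longrightarrow> smooth_on S f \<Longrightarrow> (\<And>x. x \<in> S \<Longrightarrow> f x \<noteq> 0) \<Longrightarrow> smooth_on S (\<lambda>x. inverse (f x))"
  by (auto simp: smooth_on_def intro: Ck_on_inverse)

lemma smooth_on_compose:
  fixes f :: "'a::euclidean_space \<Rightarrow> 'b::euclidean_space"
  shows "open S \<Longrightarrow> open R \<Longrightarrow> f ` S \<subseteq> R \<Longrightarrow> smooth_on S f \<Longrightarrow> smooth_on R g \<Longrightarrow>
    smooth_on S (\<lambda>x. g (f x))"
  by (auto simp: smooth_on_def intro: Ck_on_compose)

lemma smooth_on_has_derivative:
  "smooth_on S f \<Longrightarrow> x \<in> S \<Longrightarrow> (f has_derivative frechet_derivative f (at x)) (at x)"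
  using Ck_on_Suc_has_derivative[of 0] unfolding smooth_on_def by blast

lemma smooth_on_directional:
  "smooth_on S f \<Longrightarrow> smooth_on S (\<lambda>x. frechet_derivative f (at x) v)"
  using Ck_on_Suc_directional unfolding smooth_on_def by blast

lemma smooth_on_directional_field:
  fixes f :: "'a::euclidean_space \<Rightarrow> 'b::real_normed_vector"
  assumes "open S" "smooth_on S f" "smooth_on S v"
  shows "smooth_on S (\<lambda>x. frechet_derivative f (at x) (v x))"
proof (rule smooth_on_cong[OF assms(1)])
  show "smooth_on S (\<lambda>x. \<Sum>b\<in>Basis. (v x \<bullet> b) *\<^sub>R frechet_derivative f (at x) b)"
    by (intro smooth_on_sum smooth_on_scaleR smooth_on_inner_const smooth_on_directional assms)
  show "(\<Sum>b\<in>Basis. (v x \<bullet> b) *\<^sub>R frechet_derivative f (at x) b) = frechet_derivative f (at x) (v x)"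
    if "x \<in> S" for x
    by (rule linear_eq_sum_Basis[symmetric, OF has_derivative_linear[OF
          smooth_on_has_derivative[OF assms(2) that]]])
qed

section \<open>Charts, tangent vectors and differentials\<close>

lemma chart_inv_left: "is_chart c \<Longrightarrow> x \<in> chart_dom c \<Longrightarrow> chart_inv c (chart_map c x) = x"
  by (simp add: is_chart_def homeomorphism_def)

lemma chart_inv_right:
  "is_chart c \<Longrightarrow> z \<in> chart_map c ` chart_dom c \<Longrightarrow> chart_map c (chart_inv c z) = z"
  unfolding is_chart_def homeomorphism_def by blast

lemma chart_image_open:
  assumes "is_chart c" "open W" shows "open (chart_map c ` (W \<inter> chart_dom c))"
proof -
  have "openin (top_of_set (chart_map c ` chart_dom c)) (chart_map c ` (chart_dom c \<inter> W))"
    using assms by (intro homeomorphism_imp_open_map[where g = "chart_inv c"])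
      (auto simp: is_chart_def openin_open_Int)
  then show ?thesis
    using assms(1) by (auto simp: is_chart_def Int_commute dest: openin_open_trans)
qed

lemma atlas_is_chart: "smooth_atlas A \<Longrightarrow> c \<in> A \<Longrightarrow> is_chart c"
  by (simp add: smooth_atlas_def)

lemma chart_dom_open: "smooth_atlas A \<Longrightarrow> c \<in> A \<Longrightarrow> open (chart_dom c)"
  by (simp add: smooth_atlas_def is_chart_def)

lemma chart_at:
  assumes "smooth_atlas A"
  shows "chart_at A x \<in> A" "x \<in> chart_dom (chart_at A x)"
proof -
  have "x \<in> (\<Union>c\<in>A. chart_dom c)"
    using assms by (simp add: smooth_atlas_def)
  then have "\<exists>c. c \<in> A \<and> x \<in> chart_dom c"
    by blast
  from someI_ex[OF this] show "chart_at A x \<in> A" "x \<in> chart_dom (chart_at A x)"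
    by (simp_all add: chart_at_def)
qed

lemma tcoord_eq: "tcoord A d x =
    frechet_derivative (\<lambda>z. chart_map d (chart_inv (chart_at A x) z)) (at (chart_map (chart_at A x) x))"
  by (simp add: tcoord_def fun_eq_iff o_def)

lemma dmap_eq: "dmap A B f x =
    frechet_derivative (\<lambda>z. chart_map (chart_at B (f x)) (f (chart_inv (chart_at A x) z)))
      (at (chart_map (chart_at A x) x))"
  by (simp add: dmap_def fun_eq_iff o_def)

lemma dfun_eq: "dfun A h x =
    frechet_derivative (\<lambda>z. h (chart_inv (chart_at A x) z)) (at (chart_map (chart_at A x) x))"
  by (simp add: dfun_def fun_eq_iff o_def)

lemma smooth_fun_eq: "smooth_fun A W h \<longleftrightarrow>
    (\<forall>c\<in>A. smooth_on (chart_map c ` (W \<inter> chart_dom c)) (\<lambda>z. h (chart_inv c z)))"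
  by (simp add: smooth_fun_def o_def)

lemma smooth_map_identity: "smooth_atlas A \<Longrightarrow> smooth_map A A (\<lambda>x. x)"
  by (auto simp: smooth_map_def smooth_atlas_def o_def)

text \<open>
  The identity map of a manifold is an instance, so every statement below about a smooth map, and about
  fields and connections along it, also covers changes of charts and the manifold itself.
\<close>
locale smooth_mapping =
  fixes A :: "('m::{t2_space,second_countable_topology}, 'a::euclidean_space) chart set"
    and B :: "('n::{t2_space,second_countable_topology}, 'b::euclidean_space) chart set"
    and f :: "'m \<Rightarrow> 'n"
  assumes source_atlas: "smooth_atlas A"
    and target_atlas: "smooth_atlas B"
    and smooth: "smooth_map A B f"
begin

lemma continuous_mapping: "continuous_on UNIV f"
  using smooth by (simp add: smooth_map_def)

lemma open_preimage: "open W \<Longrightarrow> open (f -` W)"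
  using continuous_mapping by (simp add: continuous_on_open_vimage)

lemma open_source_image:
  assumes "open W" "c \<in> A" "d \<in> B"
  shows "open (chart_map c ` (W \<inter> chart_dom c \<inter> f -` chart_dom d))"
proof -
  have "open (W \<inter> f -` chart_dom d)"
    by (intro open_Int assms open_preimage chart_dom_open[OF target_atlas])
  from chart_image_open[OF atlas_is_chart[OF source_atlas assms(2)] this]
  show ?thesis by (simp add: Int_ac)
qed

lemma local_representative_smooth:
  "c \<in> A \<Longrightarrow> d \<in> B \<Longrightarrow> smooth_on (chart_map c ` (chart_dom c \<inter> f -` chart_dom d))
     (\<lambda>z. chart_map d (f (chart_inv c z)))"
  using smooth by (simp add: smooth_map_def o_def)

lemma local_representative_derivative:
  assumes "c \<in> A" "d \<in> B" "x \<in> chart_dom c" "f x \<in> chart_dom d"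
  shows "((\<lambda>z. chart_map d (f (chart_inv c z))) has_derivative
     frechet_derivative (\<lambda>z. chart_map d (f (chart_inv c z))) (at (chart_map c x))) (at (chart_map c x))"
  by (rule smooth_on_has_derivative[OF local_representative_smooth[OF assms(1,2)]])
     (use assms in auto)

text \<open>
  This one rule yields the change of coordinates of tangent vectors (for the identity map), the chain rule
  for differentials (for \<open>q\<close> a chart) and that for functions (for \<open>q\<close> real valued).
\<close>
lemma chain_rule:
  assumes c: "c \<in> A" "x \<in> chart_dom c" and e: "e \<in> B" "f x \<in> chart_dom e"
    and q: "(\<lambda>w. q (chart_inv e w)) differentiable (at (chart_map e (f x)))"
  shows "((\<lambda>z. q (f (chart_inv c z))) has_derivative
     (\<lambda>v. frechet_derivative (\<lambda>w. q (chart_inv e w)) (at (chart_map e (f x)))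
        (frechet_derivative (\<lambda>z. chart_map e (f (chart_inv c z))) (at (chart_map c x)) v)))
     (at (chart_map c x))"
proof -
  note ic = chart_inv_left[OF atlas_is_chart[OF source_atlas c(1)]]
  note ie = chart_inv_left[OF atlas_is_chart[OF target_atlas e(1)]]
  let ?S = "chart_map c ` (UNIV \<inter> chart_dom c \<inter> f -` chart_dom e)"
  have "((\<lambda>z. (\<lambda>w. q (chart_inv e w)) (chart_map e (f (chart_inv c z)))) has_derivative
     (\<lambda>v. frechet_derivative (\<lambda>w. q (chart_inv e w)) (at (chart_map e (f x)))
        (frechet_derivative (\<lambda>z. chart_map e (f (chart_inv c z))) (at (chart_map c x)) v)))
     (at (chart_map c x))"
    by (rule has_derivative_compose[OF local_representative_derivative[OF c(1) e(1) c(2) e(2)]])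
       (simp add: ic[OF c(2)] differentiable_has_frechet[OF q])
  then show ?thesis
    by (rule has_derivative_transform_within_open[where s = ?S])
       (use open_source_image[OF open_UNIV c(1) e(1)] c e in \<open>auto simp: ic ie\<close>)
qed

end

lemma smooth_mapping_identity: "smooth_atlas A \<Longrightarrow> smooth_mapping A A (\<lambda>x. x)"
  by (simp add: smooth_mapping_def smooth_map_identity)

lemma transition_differentiable:
  assumes "smooth_atlas A" "c \<in> A" "d \<in> A" "x \<in> chart_dom c" "x \<in> chart_dom d"
  shows "(\<lambda>z. chart_map d (chart_inv c z)) differentiable (at (chart_map c x))"
  using smooth_mapping.local_representative_derivative[OF smooth_mapping_identity[OF assms(1)] assms(2-5)]
  by (auto simp: differentiable_def)

lemma linear_tcoord:
  assumes "smooth_atlas A" "d \<in> A" "x \<in> chart_dom d"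
  shows "linear (tcoord A d x)"
  unfolding tcoord_eq
  by (rule has_derivative_linear[OF differentiable_has_frechet[OF transition_differentiable]])
     (use assms chart_at[OF assms(1)] in auto)


text \<open>
  The field with constant components \<open>w\<close> in the chart \<open>d\<close>; for \<open>w\<close> a basis vector it is a coordinate field
  of \<open>d\<close>. It is the inverse of \<open>tcoord A d\<close>, written with the differential of the inverse change of charts.
\<close>
definition coord_field ::
  "('m, 'a::euclidean_space) chart set \<Rightarrow> ('m, 'a) chart \<Rightarrow> 'a \<Rightarrow> 'm \<Rightarrow> 'a" where
  "coord_field A d w x =
     frechet_derivative (\<lambda>z. chart_map (chart_at A x) (chart_inv d z)) (at (chart_map d x)) w"

lemma linear_coord_field:
  assumes "smooth_atlas A" "d \<in> A" "x \<in> chart_dom d"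
  shows "linear (\<lambda>w. coord_field A d w x)"
  unfolding coord_field_def
  using has_derivative_linear[OF differentiable_has_frechet[OF transition_differentiable]]
    assms chart_at[OF assms(1)] by blast

lemma self_transition_derivative:
  assumes "smooth_atlas A" "d \<in> A" "x \<in> chart_dom d"
  shows "frechet_derivative (\<lambda>z. chart_map d (chart_inv d z)) (at (chart_map d x)) = (\<lambda>v. v)"
proof (rule frechet_derivative_eqI, rule has_derivative_transform_within_open[OF has_derivative_ident])
  note ch = atlas_is_chart[OF assms(1,2)]
  show "open (chart_map d ` chart_dom d)" using ch by (simp add: is_chart_def)
  show "z = chart_map d (chart_inv d z)" if "z \<in> chart_map d ` chart_dom d" for z
    using chart_inv_right[OF ch that] by simp
qed (use assms in auto)

lemma tcoord_coord_field:
  assumes A: "smooth_atlas A" and d: "d \<in> A" "x \<in> chart_dom d" and d': "d' \<in> A" "x \<in> chart_dom d'"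
  shows "tcoord A d' x (coord_field A d w x) =
    frechet_derivative (\<lambda>z. chart_map d' (chart_inv d z)) (at (chart_map d x)) w"
  using frechet_derivative_eqI[OF smooth_mapping.chain_rule[OF smooth_mapping_identity[OF A] d
      chart_at[OF A] transition_differentiable[OF A chart_at(1)[OF A] d'(1) chart_at(2)[OF A] d'(2)]]]
  by (simp add: tcoord_eq coord_field_def)

lemma tcoord_coord_field_same:
  assumes "smooth_atlas A" "d \<in> A" "x \<in> chart_dom d"
  shows "tcoord A d x (coord_field A d w x) = w"
  using tcoord_coord_field[OF assms assms(2,3)] self_transition_derivative[OF assms] by simp

lemma coord_field_tcoord:
  assumes A: "smooth_atlas A" and d: "d \<in> A" "x \<in> chart_dom d"
  shows "coord_field A d (tcoord A d x v) x = v"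
  using frechet_derivative_eqI[OF smooth_mapping.chain_rule[OF smooth_mapping_identity[OF A] 
      chart_at[OF A] d transition_differentiable[OF A d(1) chart_at(1)[OF A] d(2) chart_at(2)[OF A]]]]
    self_transition_derivative[OF A chart_at[OF A]]
  by (simp add: tcoord_eq coord_field_def fun_eq_iff)

text \<open>
  The coordinate fields form a local frame of the tangent bundle. The properties of a connection along a map
  are reduced to the fields of this frame.
\<close>
lemma coord_field_expansion:
  assumes A: "smooth_atlas A" and d: "d \<in> A" "x \<in> chart_dom d"
  shows "v = (\<Sum>b\<in>Basis. (tcoord A d x v \<bullet> b) *\<^sub>R coord_field A d b x)"
  using linear_eq_sum_Basis[OF linear_coord_field[OF assms], of "tcoord A d x v"]
  by (simp add: coord_field_tcoord[OF assms])

lemma smooth_fun_differentiable: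
  assumes "smooth_fun A W h" "c \<in> A" "x \<in> W" "x \<in> chart_dom c"
  shows "(\<lambda>z. h (chart_inv c z)) differentiable (at (chart_map c x))"
proof -
  have "smooth_on (chart_map c ` (W \<inter> chart_dom c)) (\<lambda>z. h (chart_inv c z))"
    using assms by (simp add: smooth_fun_eq)
  from smooth_on_has_derivative[OF this] assms show ?thesis
    unfolding differentiable_def by blast
qed

context smooth_mapping begin

text \<open>
  Both sides are the derivative of the same coordinate expression of \<open>f\<close>, read in the chart chosen at \<open>x\<close>:
  once factored through the chart chosen at \<open>f x\<close>, once through the chart \<open>c\<close>.
\<close>
lemma tcoord_dmap:
  assumes c: "c \<in> A" "x \<in> chart_dom c" and d: "d \<in> B" "f x \<in> chart_dom d"
  shows "tcoord B d (f x) (dmap A B f x v) =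
    frechet_derivative (\<lambda>z. chart_map d (f (chart_inv c z))) (at (chart_map c x)) (tcoord A c x v)"
proof -
  note cx = chart_at[OF source_atlas, of x] and ex = chart_at[OF target_atlas, of "f x"]
  have "((\<lambda>z. chart_map d (f (chart_inv (chart_at A x) z))) has_derivative
      (\<lambda>v. tcoord B d (f x) (dmap A B f x v))) (at (chart_map (chart_at A x) x))"
    using chain_rule[OF cx ex transition_differentiable[OF target_atlas ex(1) d(1) ex(2) d(2)]]
    by (simp add: tcoord_eq dmap_eq)
  moreover have "((\<lambda>z. chart_map d (f (chart_inv (chart_at A x) z))) has_derivative
      (\<lambda>v. frechet_derivative (\<lambda>z. chart_map d (f (chart_inv c z))) (at (chart_map c x)) (tcoord A c x v)))
      (at (chart_map (chart_at A x) x))"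
    using smooth_mapping.chain_rule[OF smooth_mapping_identity[OF source_atlas] cx c,
        of "\<lambda>y. chart_map d (f y)"]
      local_representative_derivative[OF c(1) d(1) c(2) d(2)]
    by (auto simp: tcoord_eq differentiable_def)
  ultimately show ?thesis
    using has_derivative_unique by metis
qed

lemma linear_dmap: "linear (dmap A B f x)"
  unfolding dmap_eq
  by (rule has_derivative_linear[OF local_representative_derivative])
     (use chart_at[OF source_atlas] chart_at[OF target_atlas] in auto)

lemma dfun_comp:
  assumes "smooth_fun B W h" "f x \<in> W"
  shows "dfun A (\<lambda>y. h (f y)) x v = dfun B h (f x) (dmap A B f x v)"
  using frechet_derivative_eqI[OF chain_rule[OF chart_at[OF source_atlas] chart_at[OF target_atlas]
     smooth_fun_differentiable[OF assms(1) chart_at(1)[OF target_atlas] assms(2) chart_at(2)[OF target_atlas]]]]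
  by (simp add: dfun_eq dmap_eq)

end

section \<open>Smooth functions on a manifold\<close>

lemma atlas_image_open:
  "smooth_atlas A \<Longrightarrow> open W \<Longrightarrow> c \<in> A \<Longrightarrow> open (chart_map c ` (W \<inter> chart_dom c))"
  by (blast intro: chart_image_open atlas_is_chart)

lemma smooth_fun_subset: "smooth_fun A W h \<Longrightarrow> W' \<subseteq> W \<Longrightarrow> smooth_fun A W' h"
  unfolding smooth_fun_def by (blast intro: smooth_on_subset)

lemma smooth_fun_cong:
  assumes "smooth_atlas A" "open W" "smooth_fun A W h" "\<And>y. y \<in> W \<Longrightarrow> h y = k y"
  shows "smooth_fun A W k"
  unfolding smooth_fun_eq
proof
  fix c assume c: "c \<in> A"
  note ch = atlas_is_chart[OF assms(1) c]
  show "smooth_on (chart_map c ` (W \<inter> chart_dom c)) (\<lambda>z. k (chart_inv c z))"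
    by (rule smooth_on_cong[OF chart_image_open[OF ch assms(2)],
          where f = "\<lambda>z. h (chart_inv c z)"])
      (use assms(3,4) c in \<open>auto simp: smooth_fun_eq chart_inv_left[OF ch]\<close>)
qed

lemma smooth_fun_const: "smooth_atlas A \<Longrightarrow> open W \<Longrightarrow> smooth_fun A W (\<lambda>y. k)"
  unfolding smooth_fun_eq by (intro ballI smooth_on_const) (simp_all add: atlas_image_open)

lemma smooth_fun_add:
  "smooth_atlas A \<Longrightarrow> open W \<Longrightarrow> smooth_fun A W h \<Longrightarrow> smooth_fun A W k \<Longrightarrow>
   smooth_fun A W (\<lambda>y. h y + k y)"
  unfolding smooth_fun_eq by (intro ballI smooth_on_add) (simp_all add: atlas_image_open)

lemma smooth_fun_mult:
  "smooth_atlas A \<Longrightarrow> open W \<Longrightarrow> smooth_fun A W h \<Longrightarrow> smooth_fun A W k \<Longrightarrow>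
   smooth_fun A W (\<lambda>y. h y * k y)"
  unfolding smooth_fun_eq real_scaleR_def[symmetric]
  by (intro ballI smooth_on_scaleR) (simp_all add: atlas_image_open)

lemma smooth_fun_sum:
  assumes "smooth_atlas A" "open W" "\<And>i. i \<in> I \<Longrightarrow> smooth_fun A W (h i)"
  shows "smooth_fun A W (\<lambda>y. \<Sum>i\<in>I. h i y)"
  using assms unfolding smooth_fun_eq
  by (intro ballI smooth_on_sum) (simp_all add: atlas_image_open)

lemma smooth_fun_inverse:
  assumes "smooth_atlas A" "open W" "smooth_fun A W h" "\<And>y. y \<in> W \<Longrightarrow> h y \<noteq> 0"
  shows "smooth_fun A W (\<lambda>y. inverse (h y))"
  unfolding smooth_fun_eq
proof
  fix c assume c: "c \<in> A"
  note ch = atlas_is_chart[OF assms(1) c]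
  show "smooth_on (chart_map c ` (W \<inter> chart_dom c)) (\<lambda>z. inverse (h (chart_inv c z)))"
    by (rule smooth_on_inverse[OF chart_image_open[OF ch assms(2)]])
      (use assms(3,4) c in \<open>auto simp: smooth_fun_eq chart_inv_left[OF ch]\<close>)
qed

lemma smooth_fun_local:
  assumes A: "smooth_atlas A" and h: "\<And>x. x \<in> W \<Longrightarrow> \<exists>W'. open W' \<and> x \<in> W' \<and> smooth_fun A W' h"
  shows "smooth_fun A W h"
  unfolding smooth_fun_eq
proof
  fix c assume c: "c \<in> A"
  show "smooth_on (chart_map c ` (W \<inter> chart_dom c)) (\<lambda>z. h (chart_inv c z))"
  proof (rule smooth_on_local)
    fix z assume "z \<in> chart_map c ` (W \<inter> chart_dom c)"
    then obtain x where x: "x \<in> W" "x \<in> chart_dom c" "z = chart_map c x" by blast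
    obtain W' where "open W'" "x \<in> W'" "smooth_fun A W' h" using h[OF x(1)] by blast
    then show "\<exists>R. open R \<and> z \<in> R \<and> smooth_on R (\<lambda>z. h (chart_inv c z))"
      using x c chart_image_open[OF atlas_is_chart[OF A c]]
      by (intro exI[of _ "chart_map c ` (W' \<inter> chart_dom c)"]) (auto simp: smooth_fun_eq)
  qed
qed

lemma dfun_cong:
  assumes "smooth_atlas A" "open W" "x \<in> W" "\<And>y. y \<in> W \<Longrightarrow> h y = k y"
  shows "dfun A h x v = dfun A k x v"
proof -
  let ?c = "chart_at A x"
  note c = chart_at[OF assms(1), of x]
  note ch = atlas_is_chart[OF assms(1) c(1)]
  have "frechet_derivative (\<lambda>z. h (chart_inv ?c z)) (at (chart_map ?c x)) =
      frechet_derivative (\<lambda>z. k (chart_inv ?c z)) (at (chart_map ?c x))"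
    by (rule frechet_derivative_cong_open(1)[OF chart_image_open[OF ch assms(2)]])
       (use assms(3,4) c in \<open>auto simp: chart_inv_left[OF ch]\<close>)
  then show ?thesis by (simp add: dfun_eq)
qed

lemma dfun_const: "dfun A (\<lambda>y. k) x v = 0"
  by (simp add: dfun_eq)

lemma smooth_fun_dfun:
  assumes "smooth_atlas A" "smooth_fun A W h" "x \<in> W"
  shows "((\<lambda>z. h (chart_inv (chart_at A x) z)) has_derivative dfun A h x)
     (at (chart_map (chart_at A x) x))"
  unfolding dfun_eq
  using smooth_fun_differentiable[OF assms(2) chart_at(1)[OF assms(1)] assms(3) chart_at(2)[OF assms(1)]]
  by (rule differentiable_has_frechet)

lemma dfun_mult:
  assumes A: "smooth_atlas A" and hk: "smooth_fun A W h" "smooth_fun A W k" and x: "x \<in> W"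
  shows "dfun A (\<lambda>y. h y * k y) x v = h x * dfun A k x v + dfun A h x v * k x"
  unfolding dfun_eq[of A "\<lambda>y. h y * k y"]
  using frechet_derivative_eqI[OF has_derivative_mult
     [OF smooth_fun_dfun[OF A hk(1) x] smooth_fun_dfun[OF A hk(2) x]]]
  by (simp add: chart_inv_left[OF atlas_is_chart[OF A chart_at(1)[OF A]] chart_at(2)[OF A]])

lemma dfun_sum:
  assumes A: "smooth_atlas A" and h: "\<And>i. i \<in> I \<Longrightarrow> smooth_fun A W (h i)" and x: "x \<in> W"
  shows "dfun A (\<lambda>y. \<Sum>i\<in>I. h i y) x v = (\<Sum>i\<in>I. dfun A (h i) x v)"
proof -
  have "((\<lambda>z. \<Sum>i\<in>I. h i (chart_inv (chart_at A x) z)) has_derivative (\<lambda>v. \<Sum>i\<in>I. dfun A (h i) x v))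
      (at (chart_map (chart_at A x) x))"
    by (rule has_derivative_sum) (rule smooth_fun_dfun[OF A h x])
  then show ?thesis
    by (simp add: dfun_eq[of A "\<lambda>y. \<Sum>i\<in>I. h i y"] frechet_derivative_eqI)
qed

lemma smooth_fun_chart_coordinate:
  assumes "smooth_atlas A" "d \<in> A"
  shows "smooth_fun A (chart_dom d) (\<lambda>y. chart_map d y \<bullet> b)"
  unfolding smooth_fun_eq
proof
  fix c assume c: "c \<in> A"
  show "smooth_on (chart_map c ` (chart_dom d \<inter> chart_dom c)) (\<lambda>z. chart_map d (chart_inv c z) \<bullet> b)"
  proof (rule smooth_on_inner_const)
    show "open (chart_map c ` (chart_dom d \<inter> chart_dom c))"
      by (rule chart_image_open[OF atlas_is_chart[OF assms(1) c] chart_dom_open[OF assms]])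
    show "smooth_on (chart_map c ` (chart_dom d \<inter> chart_dom c)) (\<lambda>z. chart_map d (chart_inv c z))"
      by (rule smooth_on_subset[OF smooth_mapping.local_representative_smooth[OF
            smooth_mapping_identity[OF assms(1)] c assms(2)]]) auto
  qed
qed

lemma dfun_chart_coordinate:
  assumes "smooth_atlas A" "d \<in> A" "x \<in> chart_dom d"
  shows "dfun A (\<lambda>y. chart_map d y \<bullet> b) x v = tcoord A d x v \<bullet> b"
proof -
  have "((\<lambda>z. chart_map d (chart_inv (chart_at A x) z) \<bullet> b) has_derivative (\<lambda>v. tcoord A d x v \<bullet> b))
      (at (chart_map (chart_at A x) x))"
    unfolding tcoord_eq
    by (rule has_derivative_inner_left[OF differentiable_has_frechet[OF transition_differentiable]])
      (use assms chart_at[OF assms(1)] in auto)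
  then show ?thesis
    by (simp add: dfun_eq frechet_derivative_eqI)
qed

section \<open>Smooth fields along a map\<close>

lemma smooth_field_along_subset:
  "smooth_field_along A B f W V \<Longrightarrow> W' \<subseteq> W \<Longrightarrow> smooth_field_along A B f W' V"
  unfolding smooth_field_along_def by (blast intro: smooth_on_subset)

lemma smooth_vf_subset: "smooth_vf A W V \<Longrightarrow> W' \<subseteq> W \<Longrightarrow> smooth_vf A W' V"
  unfolding smooth_vf_def by (rule smooth_field_along_subset)

lemma smooth_vf_in_chart:
  assumes "smooth_vf A W Y" "c \<in> A"
  shows "smooth_on (chart_map c ` (W \<inter> chart_dom c)) (\<lambda>z. tcoord A c (chart_inv c z) (Y (chart_inv c z)))"
proof -
  have "smooth_on (chart_map c ` (W \<inter> chart_dom c \<inter> (\<lambda>x. x) -` chart_dom c))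
      (\<lambda>z. tcoord A c (chart_inv c z) (Y (chart_inv c z)))"
    using assms unfolding smooth_vf_def smooth_field_along_def by blast
  then show ?thesis
    by (rule smooth_on_subset) blast
qed

context smooth_mapping begin

lemma in_source_image:
  assumes "c \<in> A" "z \<in> chart_map c ` (W \<inter> chart_dom c \<inter> f -` chart_dom d)"
  shows "chart_inv c z \<in> W" "chart_inv c z \<in> chart_dom c" "f (chart_inv c z) \<in> chart_dom d"
    "chart_map c (chart_inv c z) = z"
  using assms(2) chart_inv_left[OF atlas_is_chart[OF source_atlas assms(1)]] by auto

text \<open>
  A given coordinate expression \<open>F c d\<close> of \<open>V\<close> may be used instead of the one in the definition.
\<close>
lemma smooth_field_alongI:
  assumes "open W"
    and "\<And>c d. c \<in> A \<Longrightarrow> d \<in> B \<Longrightarrow>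
       smooth_on (chart_map c ` (W \<inter> chart_dom c \<inter> f -` chart_dom d)) (F c d)"
    and "\<And>c d y. c \<in> A \<Longrightarrow> d \<in> B \<Longrightarrow> y \<in> W \<Longrightarrow> y \<in> chart_dom c \<Longrightarrow> f y \<in> chart_dom d \<Longrightarrow>
       F c d (chart_map c y) = tcoord B d (f y) (V y)"
  shows "smooth_field_along A B f W V"
  unfolding smooth_field_along_def
proof (intro ballI)
  fix c d assume cd: "c \<in> A" "d \<in> B"
  show "smooth_on (chart_map c ` (W \<inter> chart_dom c \<inter> f -` chart_dom d))
     (\<lambda>z. tcoord B d (f (chart_inv c z)) (V (chart_inv c z)))"
    by (rule smooth_on_cong[OF open_source_image[OF assms(1) cd] assms(2)[OF cd]])
      (use assms(3)[OF cd] in_source_image[OF cd(1)] in metis)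
qed

lemma smooth_field_alongD:
  "smooth_field_along A B f W V \<Longrightarrow> c \<in> A \<Longrightarrow> d \<in> B \<Longrightarrow>
   smooth_on (chart_map c ` (W \<inter> chart_dom c \<inter> f -` chart_dom d))
     (\<lambda>z. tcoord B d (f (chart_inv c z)) (V (chart_inv c z)))"
  by (simp add: smooth_field_along_def)

lemma source_inv: "c \<in> A \<Longrightarrow> y \<in> chart_dom c \<Longrightarrow> chart_inv c (chart_map c y) = y"
  by (rule chart_inv_left[OF atlas_is_chart[OF source_atlas]])

lemma target_inv: "d \<in> B \<Longrightarrow> w \<in> chart_dom d \<Longrightarrow> chart_inv d (chart_map d w) = w"
  by (rule chart_inv_left[OF atlas_is_chart[OF target_atlas]])

lemma smooth_field_along_cong:
  assumes "open W" "smooth_field_along A B f W V" "\<And>y. y \<in> W \<Longrightarrow> V y = V' y"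
  shows "smooth_field_along A B f W V'"
  by (rule smooth_field_alongI[OF assms(1) smooth_field_alongD[OF assms(2)]])
     (simp_all add: source_inv assms(3))

lemma smooth_field_along_zero:
  assumes "open W" shows "smooth_field_along A B f W (\<lambda>y. 0)"
  by (rule smooth_field_alongI[OF assms smooth_on_const[OF open_source_image[OF assms]]])
     (simp_all add: linear_0[OF linear_tcoord[OF target_atlas]])

lemma smooth_field_along_add:
  assumes "open W" "smooth_field_along A B f W V" "smooth_field_along A B f W V'"
  shows "smooth_field_along A B f W (\<lambda>y. V y + V' y)"
  by (rule smooth_field_alongI[OF assms(1) smooth_on_add[OF open_source_image[OF assms(1)]
        smooth_field_alongD[OF assms(2)] smooth_field_alongD[OF assms(3)]]])
     (simp_all add: source_inv linear_add[OF linear_tcoord[OF target_atlas]])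

lemma smooth_field_along_scaleR:
  assumes "open W" "smooth_fun A W h" "smooth_field_along A B f W V"
  shows "smooth_field_along A B f W (\<lambda>y. h y *\<^sub>R V y)"
proof (rule smooth_field_alongI[OF assms(1)])
  fix c d assume cd: "c \<in> A" "d \<in> B"
  have "smooth_on (chart_map c ` (W \<inter> chart_dom c \<inter> f -` chart_dom d)) (\<lambda>z. h (chart_inv c z))"
    by (rule smooth_on_subset[where S = "chart_map c ` (W \<inter> chart_dom c)"])
       (use assms(2) cd in \<open>auto simp: smooth_fun_eq\<close>)
  from smooth_on_scaleR[OF open_source_image[OF assms(1) cd] this smooth_field_alongD[OF assms(3) cd]]
  show "smooth_on (chart_map c ` (W \<inter> chart_dom c \<inter> f -` chart_dom d))
    (\<lambda>z. h (chart_inv c z) *\<^sub>R tcoord B d (f (chart_inv c z)) (V (chart_inv c z)))" .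
qed (simp_all add: source_inv linear_cmul[OF linear_tcoord[OF target_atlas]])

lemma smooth_field_along_sum:
  assumes "open W" "\<And>i. i \<in> I \<Longrightarrow> smooth_field_along A B f W (V i)"
  shows "smooth_field_along A B f W (\<lambda>y. \<Sum>i\<in>I. V i y)"
  using assms(2)
  by (induction I rule: infinite_finite_induct)
     (auto intro: smooth_field_along_add smooth_field_along_zero assms(1))

lemma smooth_field_along_local:
  assumes "\<And>x. x \<in> W \<Longrightarrow> \<exists>W'. open W' \<and> x \<in> W' \<and> smooth_field_along A B f W' V"
  shows "smooth_field_along A B f W V"
  unfolding smooth_field_along_def
proof (intro ballI)
  fix c d assume cd: "c \<in> A" "d \<in> B"
  show "smooth_on (chart_map c ` (W \<inter> chart_dom c \<inter> f -` chart_dom d))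
     (\<lambda>z. tcoord B d (f (chart_inv c z)) (V (chart_inv c z)))" (is "smooth_on _ ?V")
  proof (rule smooth_on_local)
    fix z assume "z \<in> chart_map c ` (W \<inter> chart_dom c \<inter> f -` chart_dom d)"
    then obtain x where x: "x \<in> W" "x \<in> chart_dom c" "f x \<in> chart_dom d" "z = chart_map c x" by blast
    obtain W' where W': "open W'" "x \<in> W'" "smooth_field_along A B f W' V" using assms[OF x(1)] by blast
    then show "\<exists>R. open R \<and> z \<in> R \<and> smooth_on R ?V"
      using x cd open_source_image[OF W'(1) cd]
      by (intro exI[of _ "chart_map c ` (W' \<inter> chart_dom c \<inter> f -` chart_dom d)"])
         (auto simp: smooth_field_along_def)
  qed
qed

lemma smooth_fun_comp:
  assumes W: "open W" and h: "smooth_fun B W h"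
  shows "smooth_fun A (f -` W) (\<lambda>y. h (f y))"
  unfolding smooth_fun_eq
proof
  fix c assume c: "c \<in> A"
  show "smooth_on (chart_map c ` (f -` W \<inter> chart_dom c)) (\<lambda>z. h (f (chart_inv c z)))"
  proof (rule smooth_on_local)
    fix z assume "z \<in> chart_map c ` (f -` W \<inter> chart_dom c)"
    then obtain x where x: "f x \<in> W" "x \<in> chart_dom c" "z = chart_map c x" by blast
    define d where "d = chart_at B (f x)"
    have d: "d \<in> B" "f x \<in> chart_dom d" using chart_at[OF target_atlas] by (simp_all add: d_def)
    let ?S = "chart_map c ` (f -` W \<inter> chart_dom c \<inter> f -` chart_dom d)"
    let ?R = "chart_map d ` (W \<inter> chart_dom d)"
    have S: "open ?S" by (rule open_source_image[OF open_preimage[OF W] c d(1)])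
    have R: "open ?R" by (rule chart_image_open[OF atlas_is_chart[OF target_atlas d(1)] W])
    have "smooth_on ?S (\<lambda>z. h (chart_inv d (chart_map d (f (chart_inv c z)))))"
      by (rule smooth_on_compose[OF S R _ smooth_on_subset[OF local_representative_smooth[OF c d(1)]],
            where g = "\<lambda>w. h (chart_inv d w)"])
         (use h d in_source_image[OF c] in \<open>auto simp: smooth_fun_eq source_inv[OF c]\<close>)
    then have "smooth_on ?S (\<lambda>z. h (f (chart_inv c z)))"
      by (rule smooth_on_cong[OF S]) (auto simp: source_inv[OF c] target_inv[OF d(1)])
    then show "\<exists>R. open R \<and> z \<in> R \<and> smooth_on R (\<lambda>z. h (f (chart_inv c z)))"
      using S x d by blast
  qed
qed

lemma smooth_field_along_comp:
  assumes W: "open W" and Z: "smooth_vf B W Z"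
  shows "smooth_field_along A B f (f -` W) (\<lambda>y. Z (f y))"
proof (rule smooth_field_alongI[OF open_preimage[OF W]])
  fix c d assume c: "c \<in> A" and d: "d \<in> B"
  let ?S = "chart_map c ` (f -` W \<inter> chart_dom c \<inter> f -` chart_dom d)"
  let ?R = "chart_map d ` (W \<inter> chart_dom d)"
  let ?g = "\<lambda>w. tcoord B d (chart_inv d w) (Z (chart_inv d w))"
  have S: "open ?S" by (rule open_source_image[OF open_preimage[OF W] c d])
  have R: "open ?R"
    by (rule atlas_image_open[OF target_atlas W d])
  have g: "smooth_on ?R ?g"
    by (rule smooth_vf_in_chart[OF Z d])
  show "smooth_on ?S (\<lambda>z. ?g (chart_map d (f (chart_inv c z))))"
    by (rule smooth_on_compose[OF S R _ smooth_on_subset[OF local_representative_smooth[OF c d]] g])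
       (auto simp: source_inv[OF c])
qed (simp add: source_inv target_inv)

text \<open>
  In coordinates, \<open>df Y\<close> is the Jacobian of \<open>f\<close> applied to the components of \<open>Y\<close>.
\<close>
lemma smooth_field_along_dmap:
  assumes W: "open W" and Y: "smooth_vf A W Y"
  shows "smooth_field_along A B f W (\<lambda>y. dmap A B f y (Y y))"
proof (rule smooth_field_alongI[OF W])
  fix c d assume c: "c \<in> A" and d: "d \<in> B"
  let ?S = "chart_map c ` (W \<inter> chart_dom c \<inter> f -` chart_dom d)"
  have "smooth_on ?S (\<lambda>z. tcoord A c (chart_inv c z) (Y (chart_inv c z)))"
    by (rule smooth_on_subset[OF smooth_vf_in_chart[OF Y c]]) auto
  moreover have "smooth_on ?S (\<lambda>z. chart_map d (f (chart_inv c z)))"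
    by (rule smooth_on_subset[OF local_representative_smooth[OF c d]]) auto
  ultimately show "smooth_on ?S (\<lambda>z. frechet_derivative (\<lambda>z. chart_map d (f (chart_inv c z))) (at z)
      (tcoord A c (chart_inv c z) (Y (chart_inv c z))))"
    by (intro smooth_on_directional_field open_source_image W c d)
qed (simp add: source_inv tcoord_dmap)

lemma smooth_fun_tcoord:
  assumes "open W" "smooth_field_along A B f W V" "d \<in> B"
  shows "smooth_fun A (W \<inter> f -` chart_dom d) (\<lambda>y. tcoord B d (f y) (V y) \<bullet> b)"
  unfolding smooth_fun_eq
proof
  fix c assume c: "c \<in> A"
  have "W \<inter> f -` chart_dom d \<inter> chart_dom c = W \<inter> chart_dom c \<inter> f -` chart_dom d" by blast
  then show "smooth_on (chart_map c ` (W \<inter> f -` chart_dom d \<inter> chart_dom c))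
      (\<lambda>z. tcoord B d (f (chart_inv c z)) (V (chart_inv c z)) \<bullet> b)"
    using smooth_on_inner_const[OF open_source_image[OF assms(1) c assms(3)]
        smooth_field_alongD[OF assms(2) c assms(3)]] by simp
qed

end

lemma smooth_vf_coord_field:
  assumes A: "smooth_atlas A" and e: "e \<in> A"
  shows "smooth_vf A (chart_dom e) (coord_field A e w)"
  unfolding smooth_vf_def
proof (rule smooth_mapping.smooth_field_alongI[OF smooth_mapping_identity[OF A] chart_dom_open[OF A e]])
  interpret smooth_mapping A A "\<lambda>x. x" by (rule smooth_mapping_identity[OF A])
  fix c d assume c: "c \<in> A" and d: "d \<in> A"
  let ?S = "chart_map c ` (chart_dom e \<inter> chart_dom c \<inter> (\<lambda>x. x) -` chart_dom d)"
  let ?R = "chart_map e ` (UNIV \<inter> chart_dom e \<inter> (\<lambda>x. x) -` chart_dom d)"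
  show "smooth_on ?S (\<lambda>z. frechet_derivative (\<lambda>z. chart_map d (chart_inv e z))
      (at (chart_map e (chart_inv c z))) w)"
    by (rule smooth_on_compose[OF open_source_image[OF chart_dom_open[OF A e] c d] 
           open_source_image[OF open_UNIV e d] _ smooth_on_subset[OF local_representative_smooth[OF c e]]
           smooth_on_directional[OF smooth_on_subset[OF local_representative_smooth[OF e d]]]])
       (auto simp: source_inv[OF c])
qed (use A e in \<open>simp add: tcoord_coord_field chart_inv_left[OF atlas_is_chart]\<close>)

section \<open>Riemannian metrics and smoothness of fields\<close>

lemma metric_bilinear:
  assumes "riemannian_metric A g"
  shows "linear (g x u)" "linear (\<lambda>w. g x w u)" "g x u v = g x v u"
  using assms by (auto simp: riemannian_metric_def bilinear_def)

lemma metric_pos: "riemannian_metric A g \<Longrightarrow> v \<noteq> 0 \<Longrightarrow> g x v v > 0"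
  by (simp add: riemannian_metric_def)

lemma metric_smooth:
  "riemannian_metric A g \<Longrightarrow> open W \<Longrightarrow> smooth_vf A W X \<Longrightarrow> smooth_vf A W Y \<Longrightarrow>
   smooth_fun A W (\<lambda>x. g x (X x) (Y x))"
  by (simp add: riemannian_metric_def)

lemma metric_scale_left: "riemannian_metric A g \<Longrightarrow> g x (k *\<^sub>R u) v = k * g x u v"
  using linear_cmul[OF metric_bilinear(2)] by (metis real_scaleR_def)

lemma metric_add_left: "riemannian_metric A g \<Longrightarrow> g x (u + w) v = g x u v + g x w v"
  using linear_add[OF metric_bilinear(2)] by metis

lemma metric_diff_left: "riemannian_metric A g \<Longrightarrow> g x (u - w) v = g x u v - g x w v"
  using linear_diff[OF metric_bilinear(2)] by metis

lemma metric_sum_left: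
  "riemannian_metric A g \<Longrightarrow> g x (\<Sum>i\<in>I. u i) v = (\<Sum>i\<in>I. g x (u i) v)"
  using linear_sum[OF metric_bilinear(2)] by metis

lemma metric_eqI:
  assumes "riemannian_metric A g" "\<And>z. g x u z = g x v z" shows "u = v"
proof (rule ccontr)
  assume "u \<noteq> v"
  then have "g x (u - v) (u - v) > 0" using metric_pos[OF assms(1)] by simp
  then show False by (simp add: metric_diff_left[OF assms(1)] assms(2))
qed

text \<open>
  Cramer's rule without determinants: a combination of independent smooth fields is smooth as soon as its
  inner products with them are. One step of Gram-Schmidt elimination removes a field \<open>E i\<close>: the orthogonal
  projection \<open>P\<close> along it kills \<open>E i\<close>, keeps the remaining fields independent, and changes the inner
  products by smooth terms only.
\<close>
lemma smooth_vf_in_span: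
  assumes A: "smooth_atlas A" and g: "riemannian_metric A g" and W: "open W" and I: "finite I"
  shows "\<lbrakk>\<And>i. i \<in> I \<Longrightarrow> smooth_vf A W (E i);
    \<And>y k. y \<in> W \<Longrightarrow> (\<Sum>i\<in>I. k i *\<^sub>R E i y) = 0 \<Longrightarrow> \<forall>i\<in>I. k i = 0;
    \<And>y. y \<in> W \<Longrightarrow> \<exists>k. u y = (\<Sum>i\<in>I. k i *\<^sub>R E i y);
    \<And>i. i \<in> I \<Longrightarrow> smooth_fun A W (\<lambda>y. g y (u y) (E i y))\<rbrakk> \<Longrightarrow> smooth_vf A W u"
  using I
proof (induction I arbitrary: E u rule: finite_induct)
  case empty
  interpret smooth_mapping A A "\<lambda>x. x" by (rule smooth_mapping_identity[OF A])
  have "u y = 0" if "y \<in> W" for y using empty(3)[OF that] by simp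
  then show ?case
    unfolding smooth_vf_def by (intro smooth_field_along_cong[OF W smooth_field_along_zero[OF W]]) simp
next
  case (insert i I)
  interpret smooth_mapping A A "\<lambda>x. x" by (rule smooth_mapping_identity[OF A])
  note smooth = insert.prems(1) and indep = insert.prems(2) and span = insert.prems(3)
    and pairing = insert.prems(4)
  let ?e = "E i"
  have e: "smooth_vf A W ?e" using smooth by simp
  have e_nz: "?e y \<noteq> 0" if "y \<in> W" for y
  proof
    assume "?e y = 0"
    then have "(\<Sum>j\<in>insert i I. (if j = i then 1 else 0) *\<^sub>R E j y) = 0"
      by (intro sum.neutral) auto
    from indep[OF that this] show False by simp
  qed
  define n where "n y = g y (?e y) (?e y)" for y
  have n_pos: "n y > 0" if "y \<in> W" for y
    unfolding n_def by (rule metric_pos[OF g e_nz[OF that]])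
  have n_smooth: "smooth_fun A W (\<lambda>y. inverse (n y))"
  proof (rule smooth_fun_inverse[OF A W])
    show "smooth_fun A W n" unfolding n_def by (rule metric_smooth[OF g W e e])
    show "n y \<noteq> 0" if "y \<in> W" for y using n_pos[OF that] by simp
  qed
  define P where "P y v = v - (g y v (?e y) * inverse (n y)) *\<^sub>R ?e y" for y v
  have P_smooth: "smooth_vf A W (\<lambda>y. P y (F y))" 
    if "smooth_vf A W F" for F
  proof -
    have "smooth_field_along A A (\<lambda>x. x) W
        (\<lambda>y. F y + ((- 1) * (g y (F y) (?e y) * inverse (n y))) *\<^sub>R ?e y)"
      using that e unfolding smooth_vf_def
      by (intro smooth_field_along_add smooth_field_along_scaleR smooth_fun_mult[OF A W]
        smooth_fun_const[OF A W] n_smooth W metric_smooth[OF g]) (simp_all add: smooth_vf_def)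
    then show ?thesis by (simp add: smooth_vf_def P_def)
  qed
  have P_linear: "linear (P y)" for y
    by (rule linearI) (simp_all add: P_def metric_add_left[OF g] metric_scale_left[OF g] algebra_simps)
  have P_e: "P y (?e y) = 0" if "y \<in> W" for y
    using n_pos[OF that] by (simp add: P_def n_def)
  have P_sum: "P y (\<Sum>j\<in>insert i I. k j *\<^sub>R E j y) = (\<Sum>j\<in>I. k j *\<^sub>R P y (E j y))" if "y \<in> W" for y k
    using insert.hyps P_e[OF that]
    by (simp add: linear_add[OF P_linear] linear_sum[OF P_linear] linear_cmul[OF P_linear])
  have u: "smooth_vf A W (\<lambda>y. P y (u y))"
  proof (rule insert.IH)
    show "smooth_vf A W (\<lambda>y. P y (E j y))" if "j \<in> I" for j
      by (rule P_smooth) (simp add: smooth that)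
    show "\<forall>j\<in>I. k j = 0" if y: "y \<in> W" and 0: "(\<Sum>j\<in>I. k j *\<^sub>R P y (E j y)) = 0" for y k
    proof -
      \<comment> \<open>A relation between the projected fields lifts to one between the original fields: the kernel of the projection is spanned by the eliminated field.\<close>
      let ?s = "\<Sum>j\<in>I. k j *\<^sub>R E j y"
      have "P y ?s = 0"
        using 0 by (simp add: linear_sum[OF P_linear] linear_cmul[OF P_linear])
      moreover have "(\<Sum>j\<in>I. (if j = i then c else k j) *\<^sub>R E j y) = ?s" for c
        using insert.hyps(2) by (intro sum.cong) auto
      ultimately have "(\<Sum>j\<in>insert i I.
          (if j = i then - (g y ?s (?e y) * inverse (n y)) else k j) *\<^sub>R E j y) = 0"
        using insert.hyps by (simp add: P_def)
      from indep[OF y this] have "\<forall>j\<in>I. (if j = i then - (g y ?s (?e y) * inverse (n y)) else k j) = 0"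
        by blast
      then show ?thesis using insert.hyps(2) by metis
    qed
    show "\<exists>k. P y (u y) = (\<Sum>j\<in>I. k j *\<^sub>R P y (E j y))" if y: "y \<in> W" for y
      using span[OF y] P_sum[OF y] by metis
    show "smooth_fun A W (\<lambda>y. g y (P y (u y)) (P y (E j y)))" if j: "j \<in> I" for j
    proof (rule smooth_fun_cong[OF A W])
      show "smooth_fun A W (\<lambda>y. g y (u y) (E j y) +
          (- 1) * (g y (u y) (?e y) * inverse (n y) * g y (?e y) (E j y)))"
        using j by (intro smooth_fun_add smooth_fun_mult smooth_fun_const A W pairing n_smooth
            metric_smooth[OF g] smooth) auto
      fix y assume y: "y \<in> W"
      show "g y (u y) (E j y) + (- 1) * (g y (u y) (?e y) * inverse (n y) * g y (?e y) (E j y)) =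
          g y (P y (u y)) (P y (E j y))"
      proof -
        \<comment> \<open>The projection is self-adjoint, hence one of the two projections can be dropped from the inner product.\<close>
        have Pu: "g y (P y (u y)) (?e y) = 0"
          using n_pos[OF y]
          by (simp add: P_def n_def metric_diff_left[OF g] metric_scale_left[OF g])
        have "g y (P y (u y)) (P y (E j y)) = g y (P y (u y)) (E j y)"
          unfolding P_def[of y "E j y"]
          by (simp add: linear_diff[OF metric_bilinear(1)[OF g]] linear_cmul[OF metric_bilinear(1)[OF g]] Pu)
        then show ?thesis
          by (simp add: P_def metric_diff_left[OF g] metric_scale_left[OF g])
      qed
    qed
  qed
  have "smooth_field_along A A (\<lambda>x. x) W
        (\<lambda>y. P y (u y) + (g y (u y) (?e y) * inverse (n y)) *\<^sub>R ?e y)"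
    using u e unfolding smooth_vf_def
    by (intro smooth_field_along_add smooth_field_along_scaleR smooth_fun_mult[OF A W]
        n_smooth W pairing) simp_all
  then show ?case by (simp add: smooth_vf_def P_def)
qed

text \<open>
  This is how the tangential component of a smooth field along the submanifold is seen to be smooth: only
  its inner products with tangent fields are given explicitly.
\<close>
lemma smooth_vf_if_pairings_smooth:
  fixes A :: "('m::{t2_space,second_countable_topology}, 'a::euclidean_space) chart set"
  assumes A: "smooth_atlas A" and g: "riemannian_metric A g" and W: "open W"
    and u: "\<And>W' Z. open W' \<Longrightarrow> W' \<subseteq> W \<Longrightarrow> smooth_vf A W' Z \<Longrightarrow> smooth_fun A W' (\<lambda>y. g y (u y) (Z y))"
  shows "smooth_vf A W u"
  unfolding smooth_vf_def
proof (rule smooth_mapping.smooth_field_along_local[OF smooth_mapping_identity[OF A]])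
  fix x assume "x \<in> W"
  let ?c = "chart_at A x"
  let ?W = "W \<inter> chart_dom ?c"
  note c = chart_at[OF A, of x]
  have W': "open ?W" by (intro open_Int W chart_dom_open[OF A c(1)])
  have E: "smooth_vf A ?W (coord_field A ?c b)" for b
    by (rule smooth_vf_subset[OF smooth_vf_coord_field[OF A c(1)]]) simp
  have "smooth_vf A ?W u"
  proof (rule smooth_vf_in_span[OF A g W' finite_Basis E])
    fix y and k :: "'a \<Rightarrow> real"
    assume y: "y \<in> ?W" and 0: "(\<Sum>b\<in>Basis. k b *\<^sub>R coord_field A ?c b y) = 0"
    have yc: "y \<in> chart_dom ?c" using y by simp
    note lin = linear_coord_field[OF A c(1) yc]
    have "coord_field A ?c (\<Sum>b\<in>Basis. k b *\<^sub>R b) y = 0"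
      using 0 by (simp add: linear_sum[OF lin] linear_cmul[OF lin])
    then have "(\<Sum>b\<in>Basis. k b *\<^sub>R b) = 0"
      using tcoord_coord_field_same[OF A c(1) yc] linear_0[OF linear_tcoord[OF A c(1) yc]] by metis
    then have "(\<Sum>b\<in>Basis. k b *\<^sub>R b) \<bullet> b = 0" for b by simp
    then show "\<forall>b\<in>Basis. k b = 0"
      by (metis inner_sum_left_Basis)
  next
    fix y assume "y \<in> ?W"
    then show "\<exists>k. u y = (\<Sum>b\<in>Basis. k b *\<^sub>R coord_field A ?c b y)"
      using coord_field_expansion[OF A c(1)] by blast
  qed (rule u[OF W' _ E], simp)
  then show "\<exists>W'. open W' \<and> x \<in> W' \<and> smooth_field_along A A (\<lambda>x. x) W' u"
    using W' \<open>x \<in> W\<close> c unfolding smooth_vf_def by blast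
qed

section \<open>Connections along a map\<close>

context smooth_mapping begin

lemma connection_linear:
  assumes "connection_along A B f D" "open W" "smooth_field_along A B f W V" "x \<in> W"
  shows "linear (\<lambda>v. D x v V)"
proof -
  from assms(1)[unfolded connection_along_def, THEN spec, THEN spec, THEN mp, OF conjI, OF assms(2,3)]
  show ?thesis using assms(4) by simp
qed

lemma connection_add:
  assumes "connection_along A B f D" "open W" "x \<in> W"
    "smooth_field_along A B f W V" "smooth_field_along A B f W V'"
  shows "D x v (\<lambda>y. V y + V' y) = D x v V + D x v V'"
proof -
  from assms(1)[unfolded connection_along_def, THEN spec, THEN spec, THEN mp, OF conjI, OF assms(2,4)]
  show ?thesis using assms(3,5) by simp
qed

lemma connection_scaleR:
  assumes "connection_along A B f D" "open W" "x \<in> W"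
    "smooth_fun A W h" "smooth_field_along A B f W V"
  shows "D x v (\<lambda>y. h y *\<^sub>R V y) = dfun A h x v *\<^sub>R V x + h x *\<^sub>R D x v V"
proof -
  from assms(1)[unfolded connection_along_def, THEN spec, THEN spec, THEN mp, OF conjI, OF assms(2,5)]
  show ?thesis using assms(3,4) by simp
qed

text \<open>
  Connections are local without bump functions: the indicator function of \<open>W\<close> is smooth on \<open>W\<close>, with
  derivative zero, so multiplying a field by it does not change covariant derivatives at points of \<open>W\<close>; and the
  two cut-off fields are literally equal.
\<close>
lemma connection_cong:
  assumes D: "connection_along A B f D" and W: "open W" "x \<in> W"
    and V: "smooth_field_along A B f W V" and eq: "\<And>y. y \<in> W \<Longrightarrow> V y = V' y"
  shows "D x v V = D x v V'"
proof -
  define cut :: "'m \<Rightarrow> real" where "cut y = (if y \<in> W then 1 else 0)" for y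
  have smooth: "smooth_fun A W cut"
    by (rule smooth_fun_cong[OF source_atlas W(1) smooth_fun_const[OF source_atlas W(1), of 1]])
       (simp add: cut_def)
  have "dfun A cut x v = dfun A (\<lambda>y. 1) x v"
    by (rule dfun_cong[OF source_atlas W]) (simp add: cut_def)
  then have d: "dfun A cut x v = 0" by (simp add: dfun_const)
  have local: "D x v (\<lambda>y. cut y *\<^sub>R F y) = D x v F" if "smooth_field_along A B f W F" for F
    using connection_scaleR[OF D W smooth that] W(2) by (simp add: d cut_def)
  have "(\<lambda>y. cut y *\<^sub>R V y) = (\<lambda>y. cut y *\<^sub>R V' y)"
    using eq by (auto simp: cut_def)
  then show ?thesis
    using local[OF V] local[OF smooth_field_along_cong[OF W(1) V eq]] by simp
qed

lemma connection_zero: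
  assumes "connection_along A B f D"
  shows "D x v (\<lambda>y. 0) = 0"
  using connection_add[OF assms open_UNIV UNIV_I smooth_field_along_zero[OF open_UNIV]
    smooth_field_along_zero[OF open_UNIV], of x v] by simp

lemma connection_const_scaleR:
  assumes "connection_along A B f D" "open W" "x \<in> W" "smooth_field_along A B f W V"
  shows "D x v (\<lambda>y. k *\<^sub>R V y) = k *\<^sub>R D x v V"
  using connection_scaleR[OF assms(1-3) smooth_fun_const[OF source_atlas assms(2)] assms(4)]
  by (simp add: dfun_const)

lemma connection_sum:
  assumes D: "connection_along A B f D" and W: "open W" "x \<in> W"
    and V: "\<And>i. i \<in> I \<Longrightarrow> smooth_field_along A B f W (V i)"
  shows "D x v (\<lambda>y. \<Sum>i\<in>I. V i y) = (\<Sum>i\<in>I. D x v (V i))"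
  using V
proof (induction I rule: infinite_finite_induct)
  case (insert i I)
  have "D x v (\<lambda>y. V i y + (\<Sum>i\<in>I. V i y)) = D x v (V i) + D x v (\<lambda>y. \<Sum>i\<in>I. V i y)"
    by (intro connection_add[OF D W] smooth_field_along_sum W(1) insert.prems) simp_all
  with insert show ?case by simp
qed (simp_all add: connection_zero[OF D])

lemma connection_combination:
  assumes D: "connection_along A B f D" and W: "open W" "x \<in> W"
    and "\<And>i. i \<in> I \<Longrightarrow> smooth_fun A W (\<phi> i)"
    and "\<And>i. i \<in> I \<Longrightarrow> smooth_field_along A B f W (V i)"
  shows "D x v (\<lambda>y. \<Sum>i\<in>I. \<phi> i y *\<^sub>R V i y) =
    (\<Sum>i\<in>I. dfun A (\<phi> i) x v *\<^sub>R V i x + \<phi> i x *\<^sub>R D x v (V i))"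
proof -
  have "D x v (\<lambda>y. \<Sum>i\<in>I. \<phi> i y *\<^sub>R V i y) = (\<Sum>i\<in>I. D x v (\<lambda>y. \<phi> i y *\<^sub>R V i y))"
    by (intro connection_sum[OF D W] smooth_field_along_scaleR W(1) assms(4,5))
  also have "\<dots> = (\<Sum>i\<in>I. dfun A (\<phi> i) x v *\<^sub>R V i x + \<phi> i x *\<^sub>R D x v (V i))"
    by (intro sum.cong refl connection_scaleR[OF D W] assms(4,5))
  finally show ?thesis .
qed

lemma target_dom_open: "d \<in> B \<Longrightarrow> open (chart_dom d)"
  by (rule chart_dom_open[OF target_atlas])

lemma smooth_coord_field_along:
  assumes "d \<in> B" "W \<subseteq> f -` chart_dom d"
  shows "smooth_field_along A B f W (\<lambda>y. coord_field B d b (f y))"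
  by (rule smooth_field_along_subset[OF smooth_field_along_comp[OF target_dom_open[OF assms(1)]
    smooth_vf_coord_field[OF target_atlas assms(1)]] assms(2)])

lemma chart_neighbourhood:
  assumes "open W" "x \<in> W"
  obtains d W' where "d \<in> B" "open W'" "x \<in> W'" "W' \<subseteq> W" "W' \<subseteq> f -` chart_dom d"
proof
  note d = chart_at[OF target_atlas, of "f x"]
  show "chart_at B (f x) \<in> B" by (rule d)
  show "open (W \<inter> f -` chart_dom (chart_at B (f x)))"
    by (intro open_Int assms open_preimage target_dom_open d)
qed (use assms chart_at[OF target_atlas] in auto)

lemma smooth_fun_coefficient:
  assumes "open W" "W \<subseteq> f -` chart_dom d" "d \<in> B" "smooth_field_along A B f W V"
  shows "smooth_fun A W (\<lambda>y. tcoord B d (f y) (V y) \<bullet> b)"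
  using smooth_fun_tcoord[OF assms(1,4,3)] assms(2) by (simp add: Int_absorb2)

lemma field_along_expansion:
  assumes "d \<in> B" "W \<subseteq> f -` chart_dom d" "y \<in> W"
  shows "(\<Sum>b\<in>Basis. (tcoord B d (f y) (V y) \<bullet> b) *\<^sub>R coord_field B d b (f y)) = V y"
proof -
  have "f y \<in> chart_dom d" using assms(2,3) by blast
  then show ?thesis by (rule coord_field_expansion[OF target_atlas assms(1), symmetric])
qed

text \<open>
  A metric is only required to be smooth on pairs of vector fields of the manifold. Fields along \<open>f\<close> need not
  extend to such fields, but they are smooth combinations of coordinate fields composed with \<open>f\<close>.
\<close>
lemma smooth_metric_along:
  assumes G: "riemannian_metric B G" and W: "open W"
    and V: "smooth_field_along A B f W V" "smooth_field_along A B f W V'"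
  shows "smooth_fun A W (\<lambda>y. G (f y) (V y) (V' y))"
proof (rule smooth_fun_local[OF source_atlas])
  fix x assume "x \<in> W"
  from chart_neighbourhood[OF W this] obtain d W' where
    d: "d \<in> B" and W': "open W'" "x \<in> W'" "W' \<subseteq> W" "W' \<subseteq> f -` chart_dom d" .
  let ?E = "coord_field B d"
  note od = target_dom_open[OF d]
  note V' = smooth_field_along_subset[OF V(1) W'(3)] smooth_field_along_subset[OF V(2) W'(3)]
  have "smooth_fun A W' (\<lambda>y. \<Sum>b\<in>Basis. \<Sum>e\<in>Basis. (tcoord B d (f y) (V y) \<bullet> b) *
      ((tcoord B d (f y) (V' y) \<bullet> e) * G (f y) (?E b (f y)) (?E e (f y))))"
    by (intro smooth_fun_sum smooth_fun_mult source_atlas W'(1) smooth_fun_coefficient[OF W'(1,4) d] V'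
       smooth_fun_subset[OF smooth_fun_comp[OF od metric_smooth[OF G od]] W'(4)]
       smooth_vf_coord_field[OF target_atlas] d)
  then have "smooth_fun A W' (\<lambda>y. G (f y) (V y) (V' y))"
  proof (rule smooth_fun_cong[OF source_atlas W'(1)])
    fix y assume y: "y \<in> W'"
    have "G (f y) (V y) (V' y) =
       G (f y) (\<Sum>b\<in>Basis. (tcoord B d (f y) (V y) \<bullet> b) *\<^sub>R ?E b (f y))
         (\<Sum>e\<in>Basis. (tcoord B d (f y) (V' y) \<bullet> e) *\<^sub>R ?E e (f y))"
      by (simp add: field_along_expansion[OF d W'(4) y])
    also have "\<dots> = (\<Sum>e\<in>Basis. \<Sum>b\<in>Basis. (tcoord B d (f y) (V' y) \<bullet> e) *
        ((tcoord B d (f y) (V y) \<bullet> b) * G (f y) (?E b (f y)) (?E e (f y))))"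
      by (simp add: metric_sum_left[OF G] metric_scale_left[OF G] linear_sum[OF metric_bilinear(1)[OF G]]
         linear_cmul[OF metric_bilinear(1)[OF G]] sum_distrib_left)
    also have "\<dots> = (\<Sum>b\<in>Basis. \<Sum>e\<in>Basis. (tcoord B d (f y) (V y) \<bullet> b) *
      ((tcoord B d (f y) (V' y) \<bullet> e) * G (f y) (?E b (f y)) (?E e (f y))))"
      by (subst sum.swap) (simp only: mult.left_commute)
    finally show "(\<Sum>b\<in>Basis. \<Sum>e\<in>Basis. (tcoord B d (f y) (V y) \<bullet> b) *
      ((tcoord B d (f y) (V' y) \<bullet> e) * G (f y) (?E b (f y)) (?E e (f y)))) = G (f y) (V y) (V' y)"
      by simp
  qed
  then show "\<exists>W'. open W' \<and> x \<in> W' \<and> smooth_fun A W' (\<lambda>y. G (f y) (V y) (V' y))"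
    using W' by blast
qed

lemma smooth_tensor_along:
  assumes J: "tensor_field_11 B J" and W: "open W" and V: "smooth_field_along A B f W V"
  shows "smooth_field_along A B f W (\<lambda>y. J (f y) (V y))"
proof (rule smooth_field_along_local)
  fix x assume "x \<in> W"
  from chart_neighbourhood[OF W this] obtain d W' where
    d: "d \<in> B" and W': "open W'" "x \<in> W'" "W' \<subseteq> W" "W' \<subseteq> f -` chart_dom d" .
  let ?E = "coord_field B d"
  note od = target_dom_open[OF d]
  have JE: "smooth_vf B (chart_dom d) (\<lambda>w. J w (?E b w))" for b
    using J od smooth_vf_coord_field[OF target_atlas d] by (simp add: tensor_field_11_def)
  have lin: "linear (J w)" for w using J by (simp add: tensor_field_11_def)
  have "smooth_field_along A B f W' (\<lambda>y. \<Sum>b\<in>Basis. (tcoord B d (f y) (V y) \<bullet> b) *\<^sub>R J (f y) (?E b (f y)))"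
    by (intro smooth_field_along_sum smooth_field_along_scaleR W'(1) smooth_fun_coefficient[OF W'(1,4) d]
      smooth_field_along_subset[OF V W'(3)] smooth_field_along_subset[OF smooth_field_along_comp[OF od JE] W'(4)])
  then have "smooth_field_along A B f W' (\<lambda>y. J (f y) (V y))"
  proof (rule smooth_field_along_cong[OF W'(1)])
    fix y assume y: "y \<in> W'"
    have "J (f y) (V y) = J (f y) (\<Sum>b\<in>Basis. (tcoord B d (f y) (V y) \<bullet> b) *\<^sub>R ?E b (f y))"
      by (simp add: field_along_expansion[OF d W'(4) y])
    then show "(\<Sum>b\<in>Basis. (tcoord B d (f y) (V y) \<bullet> b) *\<^sub>R J (f y) (?E b (f y))) = J (f y) (V y)"
      by (simp add: linear_sum[OF lin] linear_cmul[OF lin])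
  qed
  then show "\<exists>W'. open W' \<and> x \<in> W' \<and> smooth_field_along A B f W' (\<lambda>y. J (f y) (V y))"
    using W' by blast
qed

lemma pullback_connection_along: "pullback_connection A B f Dbar Df \<Longrightarrow> connection_along A B f Df"
  by (simp add: pullback_connection_def)

lemma pullback_comp:
  "pullback_connection A B f Dbar Df \<Longrightarrow> open W \<Longrightarrow> smooth_vf B W Z \<Longrightarrow> f x \<in> W \<Longrightarrow>
   Df x v (\<lambda>y. Z (f y)) = Dbar (f x) (dmap A B f x v) Z"
  unfolding pullback_connection_def by blast

text \<open>
  Both sides obey the same product rule for smooth coefficients, since \<open>J\<close> is linear. It remains to compare
  them on coordinate fields composed with \<open>f\<close>, where \<open>Df\<close> is the ambient connection.
\<close>
lemma pullback_parallel_tensor: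
  assumes Df: "pullback_connection A B f Dbar Df" and J: "tensor_field_11 B J"
    and parallel: "\<And>W X Y y. open W \<Longrightarrow> smooth_vf B W X \<Longrightarrow> smooth_vf B W Y \<Longrightarrow> y \<in> W \<Longrightarrow>
      nabla_tensor Dbar J X Y y = 0"
    and W: "open W" "x \<in> W" and V: "smooth_field_along A B f W V"
  shows "Df x v (\<lambda>y. J (f y) (V y)) = J (f x) (Df x v V)"
proof -
  note conn = pullback_connection_along[OF Df]
  from chart_neighbourhood[OF W] obtain d W' where
    d: "d \<in> B" and W': "open W'" "x \<in> W'" "W' \<subseteq> W" "W' \<subseteq> f -` chart_dom d" .
  let ?E = "coord_field B d"
  let ?\<phi> = "\<lambda>b y. tcoord B d (f y) (V y) \<bullet> b"
  note od = target_dom_open[OF d]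
  have fx: "f x \<in> chart_dom d" using W'(2,4) by blast
  have E: "smooth_vf B (chart_dom d) (?E b)" for b by (rule smooth_vf_coord_field[OF target_atlas d])
  have JE: "smooth_vf B (chart_dom d) (\<lambda>w. J w (?E b w))" for b
    using J od E by (simp add: tensor_field_11_def)
  have lin: "linear (J w)" for w using J by (simp add: tensor_field_11_def)
  have V': "smooth_field_along A B f W' V" by (rule smooth_field_along_subset[OF V W'(3)])
  have \<phi>: "smooth_fun A W' (?\<phi> b)" for b by (rule smooth_fun_coefficient[OF W'(1,4) d V'])
  have Ef: "smooth_field_along A B f W' (\<lambda>y. ?E b (f y))" for b
    by (rule smooth_coord_field_along[OF d W'(4)])
  have JEf: "smooth_field_along A B f W' (\<lambda>y. J (f y) (?E b (f y)))" for b
    by (rule smooth_field_along_subset[OF smooth_field_along_comp[OF od JE] W'(4)])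
  have DJE: "Df x v (\<lambda>y. J (f y) (?E b (f y))) = J (f x) (Df x v (\<lambda>y. ?E b (f y)))" for b
  proof -
    \<comment> \<open>Parallelism is stated for directions that are values of smooth fields; this one extends the direction of differentiation.\<close>
    let ?X = "?E (tcoord B d (f x) (dmap A B f x v))"
    have X: "?X (f x) = dmap A B f x v" by (rule coord_field_tcoord[OF target_atlas d fx])
    have "nabla_tensor Dbar J ?X (?E b) (f x) = 0" by (rule parallel[OF od E E fx])
    then show ?thesis
      by (simp add: pullback_comp[OF Df od JE fx] pullback_comp[OF Df od E fx] nabla_tensor_def X)
  qed
  have DV: "Df x v V = (\<Sum>b\<in>Basis. dfun A (?\<phi> b) x v *\<^sub>R ?E b (f x) + ?\<phi> b x *\<^sub>R Df x v (\<lambda>y. ?E b (f y)))"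
    unfolding connection_combination[OF conn W'(1,2) \<phi> Ef, symmetric]
    by (rule connection_cong[OF conn W'(1,2) V']) (simp add: field_along_expansion[OF d W'(4)])
  have "J (f y) (V y) = (\<Sum>b\<in>Basis. ?\<phi> b y *\<^sub>R J (f y) (?E b (f y)))" if y: "y \<in> W'" for y
  proof -
    have "J (f y) (V y) = J (f y) (\<Sum>b\<in>Basis. ?\<phi> b y *\<^sub>R ?E b (f y))"
      by (simp add: field_along_expansion[OF d W'(4) y])
    then show ?thesis by (simp add: linear_sum[OF lin] linear_cmul[OF lin])
  qed
  then have "Df x v (\<lambda>y. J (f y) (V y)) = Df x v (\<lambda>y. \<Sum>b\<in>Basis. ?\<phi> b y *\<^sub>R J (f y) (?E b (f y)))"
    by (rule connection_cong[OF conn W'(1,2) smooth_tensor_along[OF J W'(1) V']])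
  also have "\<dots> = (\<Sum>b\<in>Basis. dfun A (?\<phi> b) x v *\<^sub>R J (f x) (?E b (f x)) +
      ?\<phi> b x *\<^sub>R J (f x) (Df x v (\<lambda>y. ?E b (f y))))"
    unfolding connection_combination[OF conn W'(1,2) \<phi> JEf] DJE ..
  also have "\<dots> = J (f x) (Df x v V)"
    by (simp add: DV linear_sum[OF lin] linear_add[OF lin] linear_cmul[OF lin])
  finally show ?thesis .
qed

text \<open>
  The compatibility of \<open>Df\<close> with the metric is preserved by smooth combinations in one argument. It is applied
  to each argument in turn.
\<close>
lemma leibniz_combination:
  assumes D: "connection_along A B f Df" and G: "riemannian_metric B G" and W: "open W" "x \<in> W"
    and \<phi>: "\<And>i. i \<in> I \<Longrightarrow> smooth_fun A W (\<phi> i)"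
    and V: "\<And>i. i \<in> I \<Longrightarrow> smooth_field_along A B f W (V i)"
    and V': "smooth_field_along A B f W V'"
    and leibniz: "\<And>i. i \<in> I \<Longrightarrow> dfun A (\<lambda>y. G (f y) (V i y) (V' y)) x v =
      G (f x) (Df x v (V i)) (V' x) + G (f x) (V i x) (Df x v V')"
  shows "dfun A (\<lambda>y. G (f y) (\<Sum>i\<in>I. \<phi> i y *\<^sub>R V i y) (V' y)) x v =
    G (f x) (Df x v (\<lambda>y. \<Sum>i\<in>I. \<phi> i y *\<^sub>R V i y)) (V' x) +
    G (f x) (\<Sum>i\<in>I. \<phi> i x *\<^sub>R V i x) (Df x v V')"
proof -
  note lin = metric_sum_left[OF G] metric_scale_left[OF G] metric_add_left[OF G]
  have GV: "smooth_fun A W (\<lambda>y. G (f y) (V i y) (V' y))" if "i \<in> I" for i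
    by (rule smooth_metric_along[OF G W(1) V[OF that] V'])
  have DV: "Df x v (\<lambda>y. \<Sum>i\<in>I. \<phi> i y *\<^sub>R V i y) =
      (\<Sum>i\<in>I. dfun A (\<phi> i) x v *\<^sub>R V i x + \<phi> i x *\<^sub>R Df x v (V i))"
    by (rule connection_combination[OF D W \<phi> V])
  have "dfun A (\<lambda>y. G (f y) (\<Sum>i\<in>I. \<phi> i y *\<^sub>R V i y) (V' y)) x v =
      dfun A (\<lambda>y. \<Sum>i\<in>I. \<phi> i y * G (f y) (V i y) (V' y)) x v"
    by (simp add: lin)
  also have "\<dots> = (\<Sum>i\<in>I. dfun A (\<lambda>y. \<phi> i y * G (f y) (V i y) (V' y)) x v)"
    by (intro dfun_sum[OF source_atlas _ W(2)] smooth_fun_mult source_atlas W(1) \<phi> GV)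
  also have "\<dots> = (\<Sum>i\<in>I. \<phi> i x * (G (f x) (Df x v (V i)) (V' x) + G (f x) (V i x) (Df x v V')) +
      dfun A (\<phi> i) x v * G (f x) (V i x) (V' x))"
    by (intro sum.cong refl) (simp add: dfun_mult[OF source_atlas \<phi> GV W(2)] leibniz)
  also have "\<dots> = G (f x) (Df x v (\<lambda>y. \<Sum>i\<in>I. \<phi> i y *\<^sub>R V i y)) (V' x) +
      G (f x) (\<Sum>i\<in>I. \<phi> i x *\<^sub>R V i x) (Df x v V')"
    by (simp add: DV lin sum.distrib distrib_left)
  finally show ?thesis .
qed

lemma pullback_metric_compatible:
  assumes Df: "pullback_connection A B f Dbar Df" and G: "riemannian_metric B G"
    and compat: "metric_compatible B G Dbar"
    and W: "open W" "x \<in> W"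
    and V: "smooth_field_along A B f W V" "smooth_field_along A B f W V'"
  shows "dfun A (\<lambda>y. G (f y) (V y) (V' y)) x v =
      G (f x) (Df x v V) (V' x) + G (f x) (V x) (Df x v V')"
proof -
  note conn = pullback_connection_along[OF Df]
  from chart_neighbourhood[OF W] obtain d W' where
    d: "d \<in> B" and W': "open W'" "x \<in> W'" "W' \<subseteq> W" "W' \<subseteq> f -` chart_dom d" .
  let ?E = "coord_field B d"
  note od = target_dom_open[OF d]
  have fx: "f x \<in> chart_dom d" using W'(2,4) by blast
  have E: "smooth_vf B (chart_dom d) (?E b)" for b by (rule smooth_vf_coord_field[OF target_atlas d])
  have Ef: "smooth_field_along A B f W' (\<lambda>y. ?E b (f y))" for b
    by (rule smooth_coord_field_along[OF d W'(4)])
  \<comment> \<open>On coordinate fields the claim is the compatibility of the ambient connection, by the chain rule.\<close>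
  have frame: "dfun A (\<lambda>y. G (f y) (?E b (f y)) (?E e (f y))) x v =
      G (f x) (Df x v (\<lambda>y. ?E b (f y))) (?E e (f x)) + G (f x) (?E b (f x)) (Df x v (\<lambda>y. ?E e (f y)))" for b e
  proof -
    have "dfun B (\<lambda>w. G w (?E b w) (?E e w)) (f x) (dmap A B f x v) =
        G (f x) (Dbar (f x) (dmap A B f x v) (?E b)) (?E e (f x)) +
        G (f x) (?E b (f x)) (Dbar (f x) (dmap A B f x v) (?E e))"
      by (rule compat[unfolded metric_compatible_def, rule_format, OF conjI[OF od conjI[OF E E]] fx])
    then show ?thesis
      using dfun_comp[OF metric_smooth[OF G od E E] fx]
      by (simp add: pullback_comp[OF Df od E fx])
  qed
  have extend: "dfun A (\<lambda>y. G (f y) (F y) (F' y)) x v =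
      G (f x) (Df x v F) (F' x) + G (f x) (F x) (Df x v F')"
    if F: "smooth_field_along A B f W' F" "smooth_field_along A B f W' F'"
      and EF: "\<And>b. dfun A (\<lambda>y. G (f y) (?E b (f y)) (F' y)) x v =
      G (f x) (Df x v (\<lambda>y. ?E b (f y))) (F' x) + G (f x) (?E b (f x)) (Df x v F')" for F F'
  proof -
    let ?F = "\<lambda>y. \<Sum>b\<in>Basis. (tcoord B d (f y) (F y) \<bullet> b) *\<^sub>R ?E b (f y)"
    have eq: "?F y = F y" if "y \<in> W'" for y
      by (rule field_along_expansion[OF d W'(4) that])
    have "dfun A (\<lambda>y. G (f y) (?F y) (F' y)) x v = dfun A (\<lambda>y. G (f y) (F y) (F' y)) x v"
      by (rule dfun_cong[OF source_atlas W'(1,2)]) (simp only: eq)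
    moreover have "Df x v ?F = Df x v F"
      by (rule connection_cong[OF conn W'(1,2) F(1) eq[symmetric], symmetric])
    moreover have "dfun A (\<lambda>y. G (f y) (?F y) (F' y)) x v =
        G (f x) (Df x v ?F) (F' x) + G (f x) (?F x) (Df x v F')"
      by (rule leibniz_combination[OF conn G W'(1,2) smooth_fun_coefficient[OF W'(1,4) d F(1)] Ef F(2) EF])
    ultimately show ?thesis
      by (simp only: eq[OF W'(2)])
  qed
  note V' = smooth_field_along_subset[OF V(1) W'(3)] smooth_field_along_subset[OF V(2) W'(3)]
  have "dfun A (\<lambda>y. G (f y) (?E b (f y)) (V' y)) x v =
      G (f x) (Df x v (\<lambda>y. ?E b (f y))) (V' x) + G (f x) (?E b (f x)) (Df x v V')" for b
    using extend[OF V'(2) Ef frame, of b] by (simp add: metric_bilinear(3)[OF G] add.commute)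
  from extend[OF V' this] show ?thesis .
qed

end

text \<open>
  The symmetry of the Christoffel symbols. By torsion-freeness the difference of the two sides differentiates a
  function like the bracket of the two coordinate fields; on the coordinate functions of \<open>d\<close> that is zero, as
  the coordinate fields map these to constants.
\<close>
lemma coord_fields_commute:
  assumes B: "smooth_atlas B" and D: "affine_connection B D" "torsion_free B D"
    and d: "d \<in> B" "x \<in> chart_dom d"
  shows "D x (coord_field B d b x) (coord_field B d e) = D x (coord_field B d e x) (coord_field B d b)"
proof -
  let ?E = "coord_field B d"
  let ?T = "D x (?E b x) (?E e) - D x (?E e x) (?E b)"
  have od: "open (chart_dom d)" by (rule chart_dom_open[OF B d(1)])
  have const: "dfun B (\<lambda>y. dfun B (\<lambda>w. chart_map d w \<bullet> i) y (?E e y)) x v = 0" for i e v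
  proof -
    have "dfun B (\<lambda>y. dfun B (\<lambda>w. chart_map d w \<bullet> i) y (?E e y)) x v = dfun B (\<lambda>y. e \<bullet> i) x v"
      by (rule dfun_cong[OF B od d(2)])
         (simp add: dfun_chart_coordinate[OF B d(1)] tcoord_coord_field_same[OF B d(1)])
    then show ?thesis by (simp add: dfun_const)
  qed
  have "dfun B (\<lambda>w. chart_map d w \<bullet> i) x ?T = 0" for i
    using D(2)[unfolded torsion_free_def, rule_format, of "chart_dom d" "?E b" "?E e" "\<lambda>w. chart_map d w \<bullet> i" x]
      smooth_vf_coord_field[OF B d(1)] smooth_fun_chart_coordinate[OF B d(1)] od d(2)
    by (simp add: const)
  then have "tcoord B d x ?T \<bullet> i = 0" for i
    by (simp only: dfun_chart_coordinate[OF B d])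
  then have "(\<Sum>i\<in>Basis. (tcoord B d x ?T \<bullet> i) *\<^sub>R ?E i x) = 0"
    by simp
  then have "?T = 0"
    by (rule coord_field_expansion[OF B d, THEN trans])
  then show ?thesis by simp
qed

context smooth_mapping begin

text \<open>
  Expand \<open>df Z = \<Sum>\<^sub>b Z(k\<^sub>b) E\<^sub>b\<close>, where \<open>k\<^sub>b\<close> are the target coordinates composed with \<open>f\<close>. In the difference, the
  terms with derivatives of the frame \<open>E\<^sub>b\<close> cancel by the symmetry of the Christoffel symbols \<open>\<Gamma>\<close>. The coefficients
  \<open>X(Y(k\<^sub>b)) - Y(X(k\<^sub>b))\<close> that remain are the derivative of \<open>k\<^sub>b\<close> along the bracket, because \<open>D\<close> is torsion-free.
\<close>
lemma pullback_torsion_free: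
  assumes Df: "pullback_connection A B f Dbar Df"
    and Dbar: "affine_connection B Dbar" "torsion_free B Dbar"
    and D: "torsion_free A D"
    and W: "open W" "x \<in> W" and XY: "smooth_vf A W X" "smooth_vf A W Y"
  shows "Df x (X x) (\<lambda>y. dmap A B f y (Y y)) - Df x (Y x) (\<lambda>y. dmap A B f y (X y)) =
    dmap A B f x (D x (X x) Y - D x (Y x) X)"
proof -
  note conn = pullback_connection_along[OF Df]
  from chart_neighbourhood[OF W] obtain d W' where
    d: "d \<in> B" and W': "open W'" "x \<in> W'" "W' \<subseteq> W" "W' \<subseteq> f -` chart_dom d" .
  let ?E = "coord_field B d"
  let ?k = "\<lambda>b y. chart_map d (f y) \<bullet> b"
  let ?T = "D x (X x) Y - D x (Y x) X"
  define \<phi> where "\<phi> Z b y = tcoord B d (f y) (dmap A B f y (Z y)) \<bullet> b" for Z b y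
  define \<Gamma> where "\<Gamma> b e = Dbar (f x) (?E b (f x)) (?E e)" for b e
  note od = target_dom_open[OF d]
  have fx: "f x \<in> chart_dom d" using W'(2,4) by blast
  have E: "smooth_vf B (chart_dom d) (?E b)" for b by (rule smooth_vf_coord_field[OF target_atlas d])
  have Ef: "smooth_field_along A B f W' (\<lambda>y. ?E b (f y))" for b
    by (rule smooth_coord_field_along[OF d W'(4)])
  have k: "smooth_fun A W' (?k b)" for b
    by (rule smooth_fun_subset[OF smooth_fun_comp[OF od smooth_fun_chart_coordinate[OF target_atlas d]] W'(4)])
  have dk: "dfun A (?k b) y v = tcoord B d (f y) (dmap A B f y v) \<bullet> b" if "y \<in> W'" for b y v
  proof -
    have fy: "f y \<in> chart_dom d" using that W'(4) by blast
    show ?thesis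
      using dfun_comp[OF smooth_fun_chart_coordinate[OF target_atlas d] fy]
        dfun_chart_coordinate[OF target_atlas d fy] by simp
  qed
  have main: "Df x v (\<lambda>y. dmap A B f y (Z y)) =
      (\<Sum>b\<in>Basis. dfun A (\<lambda>y. dfun A (?k b) y (Z y)) x v *\<^sub>R ?E b (f x)) +
      (\<Sum>b\<in>Basis. \<Sum>e\<in>Basis. (\<phi> Z b x * (tcoord B d (f x) (dmap A B f x v) \<bullet> e)) *\<^sub>R \<Gamma> e b)"
    if Z: "smooth_vf A W Z" for Z v
  proof -
    let ?v = "dmap A B f x v"
    have fZ: "smooth_field_along A B f W' (\<lambda>y. dmap A B f y (Z y))"
      by (rule smooth_field_along_dmap[OF W'(1) smooth_vf_subset[OF Z W'(3)]])
    have \<phi>: "smooth_fun A W' (\<phi> Z b)" for b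
      unfolding \<phi>_def by (rule smooth_fun_coefficient[OF W'(1,4) d fZ])
    have d\<phi>: "dfun A (\<phi> Z b) x v = dfun A (\<lambda>y. dfun A (?k b) y (Z y)) x v" for b
      by (rule dfun_cong[OF source_atlas W'(1,2)]) (simp add: dk \<phi>_def)
    have DE: "Df x v (\<lambda>y. ?E b (f y)) = (\<Sum>e\<in>Basis. (tcoord B d (f x) ?v \<bullet> e) *\<^sub>R \<Gamma> e b)" for b
    proof -
      have lin: "linear (\<lambda>u. Dbar (f x) u (?E b))"
        by (rule smooth_mapping.connection_linear[OF smooth_mapping_identity[OF target_atlas]
            Dbar(1)[unfolded affine_connection_def] od E[unfolded smooth_vf_def] fx])
      have "Df x v (\<lambda>y. ?E b (f y)) = Dbar (f x) ?v (?E b)"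
        by (rule pullback_comp[OF Df od E fx])
      also have "\<dots> = Dbar (f x) (\<Sum>e\<in>Basis. (tcoord B d (f x) ?v \<bullet> e) *\<^sub>R ?E e (f x)) (?E b)"
        by (rule arg_cong[where f = "\<lambda>u. Dbar (f x) u (?E b)"])
           (rule coord_field_expansion[OF target_atlas d fx])
      finally show ?thesis
        by (simp add: linear_sum[OF lin] linear_cmul[OF lin] \<Gamma>_def)
    qed
    have "Df x v (\<lambda>y. dmap A B f y (Z y)) = Df x v (\<lambda>y. \<Sum>b\<in>Basis. \<phi> Z b y *\<^sub>R ?E b (f y))"
      by (rule connection_cong[OF conn W'(1,2) fZ])
         (simp add: \<phi>_def field_along_expansion[OF d W'(4), where V = "\<lambda>y. dmap A B f y (Z y)"])
    also have "\<dots> = (\<Sum>b\<in>Basis. dfun A (\<phi> Z b) x v *\<^sub>R ?E b (f x) + \<phi> Z b x *\<^sub>R Df x v (\<lambda>y. ?E b (f y)))"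
      by (rule connection_combination[OF conn W'(1,2) \<phi> Ef])
    finally show ?thesis
      by (simp add: d\<phi> DE sum.distrib scaleR_sum_right)
  qed
  have \<Gamma>: "\<Gamma> b e = \<Gamma> e b" for b e
    unfolding \<Gamma>_def by (rule coord_fields_commute[OF target_atlas Dbar d fx])
  have quad: "(\<Sum>b\<in>Basis. \<Sum>e\<in>Basis. (\<phi> Y b x * \<phi> X e x) *\<^sub>R \<Gamma> e b) =
      (\<Sum>b\<in>Basis. \<Sum>e\<in>Basis. (\<phi> X b x * \<phi> Y e x) *\<^sub>R \<Gamma> e b)"
    by (subst sum.swap, intro sum.cong refl) (subst \<Gamma>, simp add: mult.commute)
  have "Df x (X x) (\<lambda>y. dmap A B f y (Y y)) - Df x (Y x) (\<lambda>y. dmap A B f y (X y)) =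
     (\<Sum>b\<in>Basis. (dfun A (\<lambda>y. dfun A (?k b) y (Y y)) x (X x) -
        dfun A (\<lambda>y. dfun A (?k b) y (X y)) x (Y x)) *\<^sub>R ?E b (f x))"
    using quad by (simp add: main[OF XY(1)] main[OF XY(2)] \<phi>_def scaleR_diff_left sum_subtractf)
  also have "\<dots> = (\<Sum>b\<in>Basis. dfun A (?k b) x ?T *\<^sub>R ?E b (f x))"
  proof (intro sum.cong refl)
    fix b
    have "dfun A (?k b) x ?T = dfun A (\<lambda>y. dfun A (?k b) y (Y y)) x (X x) -
        dfun A (\<lambda>y. dfun A (?k b) y (X y)) x (Y x)"
      using D[unfolded torsion_free_def, rule_format, of W' X Y "?k b" x] W'
        smooth_vf_subset[OF XY(1) W'(3)] smooth_vf_subset[OF XY(2) W'(3)] k by blast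
    then show "(dfun A (\<lambda>y. dfun A (?k b) y (Y y)) x (X x) -
        dfun A (\<lambda>y. dfun A (?k b) y (X y)) x (Y x)) *\<^sub>R ?E b (f x) = dfun A (?k b) x ?T *\<^sub>R ?E b (f x)"
      by simp
  qed
  also have "\<dots> = dmap A B f x ?T"
    unfolding dk[OF W'(2)] by (rule coord_field_expansion[OF target_atlas d fx, symmetric])
  finally show ?thesis .
qed

end

section \<open>Submanifolds of locally metallic manifolds\<close>

text \<open>
  A submanifold of a locally metallic Riemannian manifold with its induced structure: the setting of the
  formula for \<open>\<nabla>T\<close>, which the slant condition then turns into one for \<open>\<nabla>T\<^sup>2\<close>.
\<close>
locale metallic_submanifold =
  fixes A :: "('m::{t2_space,second_countable_topology}, 'a::euclidean_space) chart set"
    and B :: "('n::{t2_space,second_countable_topology}, 'b::euclidean_space) chart set"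
    and r p q :: nat
    and g :: "'m \<Rightarrow> 'a \<Rightarrow> 'a \<Rightarrow> real" and gbar :: "'n \<Rightarrow> 'b \<Rightarrow> 'b \<Rightarrow> real"
    and J :: "'n \<Rightarrow> 'b \<Rightarrow> 'b" and f :: "'m \<Rightarrow> 'n"
    and D :: "('m, 'a, 'a) connection" and Dbar :: "('n, 'b, 'b) connection"
    and Df :: "('m, 'a, 'b) connection"
    and U :: "'m set" and N :: "nat \<Rightarrow> 'm \<Rightarrow> 'b"
    and T :: "'m \<Rightarrow> 'a \<Rightarrow> 'a" and \<eta> :: "nat \<Rightarrow> 'm \<Rightarrow> 'a \<Rightarrow> real"
    and \<xi> :: "nat \<Rightarrow> 'm \<Rightarrow> 'a" and a :: "nat \<Rightarrow> nat \<Rightarrow> 'm \<Rightarrow> real"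
    and h :: "nat \<Rightarrow> 'm \<Rightarrow> 'a \<Rightarrow> 'a \<Rightarrow> real" and AN :: "nat \<Rightarrow> 'm \<Rightarrow> 'a \<Rightarrow> 'a"
  assumes ambient: "locally_metallic B J gbar p q Dbar"
    and atlas: "smooth_atlas A" and metric: "riemannian_metric A g"
    and isometric: "isometric_immersion A B g gbar f"
    and levi_civita: "levi_civita A g D" and pullback: "pullback_connection A B f Dbar Df"
    and open_U: "open U" and frame: "orthonormal_normal_frame A B gbar f U r N"
    and gauss: "second_fundamental_forms A B f D Df U r N h"
    and shape: "shape_operators g U r h AN"
    and induced: "induced_structure A B gbar f J U r N T \<eta> \<xi> a"
begin

lemma metallic: "metallic_riemannian B J gbar p q"
  using ambient by (simp add: locally_metallic_def)

sublocale smooth_mapping A B f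
  using metallic isometric atlas
  by unfold_locales (simp_all add: metallic_riemannian_def isometric_immersion_def)

abbreviation df :: "'m \<Rightarrow> 'a \<Rightarrow> 'b" where "df \<equiv> dmap A B f"

lemma ambient_metric: "riemannian_metric B gbar"
  using metallic by (simp add: metallic_riemannian_def)

lemma structure_tensor: "tensor_field_11 B J"
  using metallic by (simp add: metallic_riemannian_def)

lemma structure_linear: "linear (J y)"
  using structure_tensor by (simp add: tensor_field_11_def)

lemma structure_self_adjoint: "gbar y (J y u) v = gbar y u (J y v)"
  using metallic by (simp add: metallic_riemannian_def)

lemma structure_square: "J y (J y v) = real p *\<^sub>R J y v + real q *\<^sub>R v"
  using metallic by (simp add: metallic_riemannian_def)

lemma isometry: "gbar (f x) (df x u) (df x v) = g x u v"
  using isometric by (simp add: isometric_immersion_def)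

lemma pullback_along: "connection_along A B f Df"
  by (rule pullback_connection_along[OF pullback])

lemma submanifold_connection: "connection_along A A (\<lambda>x. x) D"
  using levi_civita by (simp add: levi_civita_def affine_connection_def)

lemma frame_smooth: "\<alpha> \<in> {1..r} \<Longrightarrow> smooth_field_along A B f U (N \<alpha>)"
  using frame unfolding orthonormal_normal_frame_def by blast

lemma frame_normal: "x \<in> U \<Longrightarrow> \<alpha> \<in> {1..r} \<Longrightarrow> gbar (f x) (N \<alpha> x) (df x v) = 0"
  using frame unfolding orthonormal_normal_frame_def normal_space_def by blast

lemma frame_orthonormal:
  "x \<in> U \<Longrightarrow> \<alpha> \<in> {1..r} \<Longrightarrow> \<beta> \<in> {1..r} \<Longrightarrow>
   gbar (f x) (N \<alpha> x) (N \<beta> x) = (if \<alpha> = \<beta> then 1 else 0)"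
  using frame unfolding orthonormal_normal_frame_def by blast

lemma gbar_normal_combination_tangent:
  assumes "x \<in> U" shows "gbar (f x) (\<Sum>\<alpha>=1..r. k \<alpha> *\<^sub>R N \<alpha> x) (df x v) = 0"
  by (simp add: metric_sum_left[OF ambient_metric] metric_scale_left[OF ambient_metric] frame_normal[OF assms])

lemma gbar_normal_combination_frame:
  assumes "x \<in> U" "\<beta> \<in> {1..r}"
  shows "gbar (f x) (\<Sum>\<alpha>=1..r. k \<alpha> *\<^sub>R N \<alpha> x) (N \<beta> x) = k \<beta>"
proof -
  have "gbar (f x) (\<Sum>\<alpha>=1..r. k \<alpha> *\<^sub>R N \<alpha> x) (N \<beta> x) = (\<Sum>\<alpha>=1..r. k \<alpha> * gbar (f x) (N \<alpha> x) (N \<beta> x))"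
    by (simp only: metric_sum_left[OF ambient_metric] metric_scale_left[OF ambient_metric])
  also have "\<dots> = (\<Sum>\<alpha>=1..r. if \<alpha> = \<beta> then k \<alpha> else 0)"
    by (intro sum.cong refl) (simp add: frame_orthonormal[OF assms(1) _ assms(2)])
  also have "\<dots> = k \<beta>" using assms(2) by simp
  finally show ?thesis .
qed

lemma gauss_formula:
  assumes "open W" "W \<subseteq> U" "smooth_vf A W X" "smooth_vf A W Y" "x \<in> W"
  shows "Df x (X x) (\<lambda>y. df y (Y y)) = df x (D x (X x) Y) + (\<Sum>\<alpha>=1..r. h \<alpha> x (X x) (Y x) *\<^sub>R N \<alpha> x)"
  using gauss[unfolded second_fundamental_forms_def, rule_format, of W X Y x] assms by simp

text \<open>
  The Gauss formula speaks of values of smooth fields. Coordinate fields supply them for arbitrary tangent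
  vectors, on one neighbourhood common to all vectors.
\<close>
lemma extend_vector:
  assumes "x \<in> U"
  obtains W where "open W" "x \<in> W" "W \<subseteq> U" "\<forall>v. \<exists>X. smooth_vf A W X \<and> X x = v"
proof
  let ?c = "chart_at A x"
  note c = chart_at[OF atlas, of x]
  show "open (U \<inter> chart_dom ?c)" by (intro open_Int open_U chart_dom_open[OF atlas c(1)])
  show "\<forall>v. \<exists>X. smooth_vf A (U \<inter> chart_dom ?c) X \<and> X x = v"
  proof (intro allI exI conjI)
    fix v
    show "smooth_vf A (U \<inter> chart_dom ?c) (coord_field A ?c (tcoord A ?c x v))"
      by (rule smooth_vf_subset[OF smooth_vf_coord_field[OF atlas c(1)]]) simp
    show "coord_field A ?c (tcoord A ?c x v) x = v" by (rule coord_field_tcoord[OF atlas c])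
  qed
qed (use assms chart_at[OF atlas] in auto)

text \<open>
  The normal component of \<open>Df\<^sub>X (df Y) - Df\<^sub>Y (df X)\<close> vanishes, because this difference is tangent.
\<close>
lemma second_fundamental_form_symmetric:
  assumes x: "x \<in> U" and \<alpha>: "\<alpha> \<in> {1..r}"
  shows "h \<alpha> x u v = h \<alpha> x v u"
proof -
  from extend_vector[OF x] obtain W where
    W: "open W" "x \<in> W" "W \<subseteq> U" and ext: "\<forall>v. \<exists>X. smooth_vf A W X \<and> X x = v" .
  obtain X Y where XY: "smooth_vf A W X" "X x = u" "smooth_vf A W Y" "Y x = v"
    using ext by metis
  have "Df x (X x) (\<lambda>y. df y (Y y)) - Df x (Y x) (\<lambda>y. df y (X y)) = df x (D x (X x) Y - D x (Y x) X)"
    by (rule pullback_torsion_free[OF pullback _ _ _ W(1,2) XY(1,3)])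
       (use ambient levi_civita in \<open>simp_all add: locally_metallic_def levi_civita_def\<close>)
  then have "(\<Sum>\<alpha>=1..r. h \<alpha> x u v *\<^sub>R N \<alpha> x) = (\<Sum>\<alpha>=1..r. h \<alpha> x v u *\<^sub>R N \<alpha> x)"
    unfolding gauss_formula[OF W(1,3) XY(1,3) W(2)] gauss_formula[OF W(1,3) XY(3,1) W(2)]
      linear_diff[OF linear_dmap] by (simp add: algebra_simps XY(2,4))
  then show ?thesis
    using gbar_normal_combination_frame[OF x \<alpha>] by metis
qed

text \<open>
  Differentiate \<open>gbar(N \<alpha>, df Z) = 0\<close> and use the Gauss formula for \<open>Df (df Z)\<close>.
\<close>
lemma weingarten:
  assumes x: "x \<in> U" and \<alpha>: "\<alpha> \<in> {1..r}"
  shows "gbar (f x) (Df x v (N \<alpha>)) (df x z) = - h \<alpha> x v z"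
proof -
  from extend_vector[OF x] obtain W where
    W: "open W" "x \<in> W" "W \<subseteq> U" and ext: "\<forall>v. \<exists>X. smooth_vf A W X \<and> X x = v" .
  obtain X Z where XZ: "smooth_vf A W X" "X x = v" "smooth_vf A W Z" "Z x = z"
    using ext by metis
  have dfZ: "smooth_field_along A B f W (\<lambda>y. df y (Z y))"
    by (rule smooth_field_along_dmap[OF W(1) XZ(3)])
  have "dfun A (\<lambda>y. gbar (f y) (N \<alpha> y) (df y (Z y))) x v = dfun A (\<lambda>y. 0) x v"
    by (rule dfun_cong[OF atlas W(1,2)]) (use W(3) frame_normal \<alpha> in blast)
  then have "gbar (f x) (Df x v (N \<alpha>)) (df x (Z x)) + gbar (f x) (N \<alpha> x) (Df x v (\<lambda>y. df y (Z y))) = 0"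
    using pullback_metric_compatible[OF pullback ambient_metric _ W(1,2)
        smooth_field_along_subset[OF frame_smooth[OF \<alpha>] W(3)] dfZ, of v] ambient
    by (simp add: dfun_const locally_metallic_def levi_civita_def)
  moreover have "gbar (f x) (N \<alpha> x) (Df x v (\<lambda>y. df y (Z y))) = h \<alpha> x v z"
    unfolding gauss_formula[OF W(1,3) XZ(1,3) W(2), unfolded XZ(2,4)]
      linear_add[OF metric_bilinear(1)[OF ambient_metric]] frame_normal[OF x \<alpha>]
      metric_bilinear(3)[OF ambient_metric, of _ "N \<alpha> x"] gbar_normal_combination_frame[OF x \<alpha>]
    by (simp add: metric_bilinear(3)[OF ambient_metric, of _ "df x _" "N \<alpha> x"] frame_normal[OF x \<alpha>])
  ultimately show ?thesis by (simp add: XZ(4))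
qed

text \<open>
  This determines \<open>T\<close>, since \<open>g\<close> is nondegenerate. Linearity, self-adjointness and smoothness of \<open>T\<close> are
  inherited from \<open>J\<close> through it.
\<close>
lemma tangential_part: "gbar (f x) (J (f x) (df x u)) (df x v) = g x (T x u) v"
proof -
  have "gbar (f x) (J (f x) (df x u) - df x (T x u)) (df x v) = 0"
    using induced unfolding induced_structure_def normal_space_def by blast
  then show ?thesis by (simp add: metric_diff_left[OF ambient_metric] isometry)
qed

lemma T_self_adjoint: "g x (T x u) v = g x u (T x v)"
  using tangential_part[of x u v] tangential_part[of x v u] structure_self_adjoint[of "f x" "df x u" "df x v"]
  by (simp add: metric_bilinear(3)[OF ambient_metric, of _ "df x u"] metric_bilinear(3)[OF metric, of x u])

lemma T_linear: "linear (T x)"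
proof (rule linearI)
  show "T x (u + v) = T x u + T x v" for u v
    by (rule metric_eqI[OF metric, where x = x])
       (simp add: tangential_part[symmetric] metric_add_left[OF metric] metric_add_left[OF ambient_metric]
         linear_add[OF linear_dmap] linear_add[OF structure_linear])
  show "T x (k *\<^sub>R v) = k *\<^sub>R T x v" for k v
    by (rule metric_eqI[OF metric, where x = x])
       (simp add: tangential_part[symmetric] metric_scale_left[OF metric] metric_scale_left[OF ambient_metric]
         linear_cmul[OF linear_dmap] linear_cmul[OF structure_linear])
qed

lemma T_smooth:
  assumes "open W" "smooth_vf A W Y"
  shows "smooth_vf A W (\<lambda>y. T y (Y y))"
proof (rule smooth_vf_if_pairings_smooth[OF atlas metric assms(1)])
  fix W' Z assume W': "open W'" "W' \<subseteq> W" and Z: "smooth_vf A W' Z"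
  show "smooth_fun A W' (\<lambda>y. g y (T y (Y y)) (Z y))"
    unfolding tangential_part[symmetric]
    by (rule smooth_metric_along[OF ambient_metric W'(1) smooth_tensor_along[OF structure_tensor W'(1)
          smooth_field_along_dmap[OF W'(1) smooth_vf_subset[OF assms(2) W'(2)]]]
          smooth_field_along_dmap[OF W'(1) Z]])
qed

lemma normal_part:
  "x \<in> U \<Longrightarrow> J (f x) (df x v) = df x (T x v) + (\<Sum>\<alpha>=1..r. \<eta> \<alpha> x v *\<^sub>R N \<alpha> x)"
  using induced unfolding induced_structure_def by blast

lemma eta_as_pairing:
  assumes "x \<in> U" "\<alpha> \<in> {1..r}"
  shows "gbar (f x) (J (f x) (df x v)) (N \<alpha> x) = \<eta> \<alpha> x v"
  by (simp del: One_nat_def add: normal_part[OF assms(1)] metric_add_left[OF ambient_metric]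
      gbar_normal_combination_frame[OF assms] metric_bilinear(3)[OF ambient_metric, of _ "df x _" "N \<alpha> x"]
      frame_normal[OF assms])

lemma xi_as_pairing:
  assumes "x \<in> U" "\<alpha> \<in> {1..r}"
  shows "gbar (f x) (J (f x) (N \<alpha> x)) (df x z) = g x (\<xi> \<alpha> x) z"
proof -
  have "J (f x) (N \<alpha> x) = df x (\<xi> \<alpha> x) + (\<Sum>\<beta>=1..r. a \<alpha> \<beta> x *\<^sub>R N \<beta> x)"
    using induced assms unfolding induced_structure_def by blast
  then show ?thesis
    by (simp del: One_nat_def add: metric_add_left[OF ambient_metric] gbar_normal_combination_tangent[OF assms(1)] isometry)
qed

text \<open>
  Differentiate \<open>J (df Y) = df (T Y) + \<Sum> \<eta>\<^sub>\<alpha>(Y) N\<^sub>\<alpha>\<close> in the direction \<open>X\<close> and take tangential parts, that is, inner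
  products with \<open>df z\<close>. On the left \<open>J\<close> is parallel, so the Gauss formula gives \<open>T(\<nabla>\<^sub>X Y) + \<Sum> h\<^sub>\<alpha>(X,Y) \<xi>\<^sub>\<alpha>\<close>; on the right
  the Gauss and Weingarten formulas give \<open>\<nabla>\<^sub>X(T Y) - \<Sum> \<eta>\<^sub>\<alpha>(Y) A\<^sub>\<alpha> X\<close>.
\<close>
lemma nabla_T:
  assumes W: "open W" "W \<subseteq> U" and XY: "smooth_vf A W X" "smooth_vf A W Y" and x: "x \<in> W"
  shows "nabla_tensor D T X Y x =
    (\<Sum>\<alpha>=1..r. \<eta> \<alpha> x (Y x) *\<^sub>R AN \<alpha> x (X x) + h \<alpha> x (X x) (Y x) *\<^sub>R \<xi> \<alpha> x)"
proof (rule metric_eqI[OF metric, where x = x])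
  fix z
  let ?v = "X x" and ?G = "gbar (f x)"
  let ?TY = "\<lambda>y. T y (Y y)"
  note G_lin = metric_add_left[OF ambient_metric] metric_sum_left[OF ambient_metric]
    metric_scale_left[OF ambient_metric]
  have xU: "x \<in> U" using W(2) x by blast
  have TY: "smooth_vf A W ?TY" by (rule T_smooth[OF W(1) XY(2)])
  have fY: "smooth_field_along A B f W (\<lambda>y. df y (Y y))"
    by (rule smooth_field_along_dmap[OF W(1) XY(2)])
  have JfY: "smooth_field_along A B f W (\<lambda>y. J (f y) (df y (Y y)))"
    by (rule smooth_tensor_along[OF structure_tensor W(1) fY])
  have fTY: "smooth_field_along A B f W (\<lambda>y. df y (?TY y))"
    by (rule smooth_field_along_dmap[OF W(1) TY])
  have N: "smooth_field_along A B f W (N \<alpha>)" if "\<alpha> \<in> {1..r}" for \<alpha>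
    by (rule smooth_field_along_subset[OF frame_smooth[OF that] W(2)])
  have \<eta>: "smooth_fun A W (\<lambda>y. \<eta> \<alpha> y (Y y))" if \<alpha>: "\<alpha> \<in> {1..r}" for \<alpha>
    by (rule smooth_fun_cong[OF atlas W(1) smooth_metric_along[OF ambient_metric W(1) JfY N[OF \<alpha>]]])
       (use W(2) eta_as_pairing \<alpha> in blast)
  have \<eta>N: "smooth_field_along A B f W (\<lambda>y. \<Sum>\<alpha>=1..r. \<eta> \<alpha> y (Y y) *\<^sub>R N \<alpha> y)"
    by (intro smooth_field_along_sum smooth_field_along_scaleR W(1) \<eta> N)
  have "Df x ?v (\<lambda>y. J (f y) (df y (Y y))) =
      Df x ?v (\<lambda>y. df y (?TY y) + (\<Sum>\<alpha>=1..r. \<eta> \<alpha> y (Y y) *\<^sub>R N \<alpha> y))"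
    by (rule connection_cong[OF pullback_along W(1) x JfY]) (use W(2) normal_part in blast)
  also have "\<dots> = Df x ?v (\<lambda>y. df y (?TY y)) + Df x ?v (\<lambda>y. \<Sum>\<alpha>=1..r. \<eta> \<alpha> y (Y y) *\<^sub>R N \<alpha> y)"
    by (rule connection_add[OF pullback_along W(1) x fTY \<eta>N])
  also have "Df x ?v (\<lambda>y. \<Sum>\<alpha>=1..r. \<eta> \<alpha> y (Y y) *\<^sub>R N \<alpha> y) =
      (\<Sum>\<alpha>=1..r. dfun A (\<lambda>y. \<eta> \<alpha> y (Y y)) x ?v *\<^sub>R N \<alpha> x + \<eta> \<alpha> x (Y x) *\<^sub>R Df x ?v (N \<alpha>))"
    by (rule connection_combination[OF pullback_along W(1) x \<eta> N])
  finally have "?G (Df x ?v (\<lambda>y. J (f y) (df y (Y y)))) (df x z) =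
      ?G (Df x ?v (\<lambda>y. df y (?TY y))) (df x z) +
      (\<Sum>\<alpha>=1..r. \<eta> \<alpha> x (Y x) * ?G (Df x ?v (N \<alpha>)) (df x z))"
    by (simp add: G_lin frame_normal[OF xU])
  also have "?G (Df x ?v (\<lambda>y. df y (?TY y))) (df x z) = g x (D x ?v ?TY) z"
    by (simp del: One_nat_def add: gauss_formula[OF W XY(1) TY x] G_lin(1) gbar_normal_combination_tangent[OF xU] isometry)
  also have "(\<Sum>\<alpha>=1..r. \<eta> \<alpha> x (Y x) * ?G (Df x ?v (N \<alpha>)) (df x z)) =
      - (\<Sum>\<alpha>=1..r. \<eta> \<alpha> x (Y x) * g x (AN \<alpha> x ?v) z)"
    using shape xU by (simp add: weingarten[OF xU] shape_operators_def sum_negf)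
  also have "Df x ?v (\<lambda>y. J (f y) (df y (Y y))) = J (f x) (Df x ?v (\<lambda>y. df y (Y y)))"
    by (rule pullback_parallel_tensor[OF pullback structure_tensor _ W(1) x fY])
       (use ambient in \<open>simp add: locally_metallic_def\<close>)
  also have "\<dots> = J (f x) (df x (D x ?v Y)) + (\<Sum>\<alpha>=1..r. h \<alpha> x ?v (Y x) *\<^sub>R J (f x) (N \<alpha> x))"
    by (simp add: gauss_formula[OF W XY x] linear_add[OF structure_linear] linear_sum[OF structure_linear]
        linear_cmul[OF structure_linear])
  also have "?G \<dots> (df x z) = g x (T x (D x ?v Y)) z + (\<Sum>\<alpha>=1..r. h \<alpha> x ?v (Y x) * g x (\<xi> \<alpha> x) z)"
    by (simp add: G_lin tangential_part xi_as_pairing[OF xU])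
  finally show "g x (nabla_tensor D T X Y x) z =
     g x (\<Sum>\<alpha>=1..r. \<eta> \<alpha> x (Y x) *\<^sub>R AN \<alpha> x ?v + h \<alpha> x ?v (Y x) *\<^sub>R \<xi> \<alpha> x) z"
    by (simp add: nabla_tensor_def metric_diff_left[OF metric] metric_sum_left[OF metric]
        metric_add_left[OF metric] metric_scale_left[OF metric] sum.distrib)
qed

text \<open>
  The slant condition says \<open>|T v|\<^sup>2 = cos\<^sup>2\<theta> |J v|\<^sup>2\<close>, and \<open>|J v|\<^sup>2 = g(J\<^sup>2 v, v)\<close> is evaluated with the metallic equation.
  The quotient in the definition of the angle is a number in \<open>[0, 1]\<close>: \<open>J v \<noteq> 0\<close> since \<open>q > 0\<close>, and \<open>|T v| \<le> |J v|\<close>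
  since the normal part \<open>?w\<close> of \<open>J v\<close> is orthogonal to \<open>T v\<close>.
\<close>
lemma slant_norm:
  assumes slant: "slant A B g gbar f J T \<theta>"
  shows "g x (T x v) (T x v) = (cos \<theta>)\<^sup>2 * (real p * g x (T x v) v + real q * g x v v)"
proof (cases "v = 0")
  case True
  then show ?thesis by (simp add: linear_0[OF T_linear] linear_0[OF metric_bilinear(2)[OF metric]])
next
  case False
  let ?Jv = "J (f x) (df x v)"
  let ?w = "?Jv - df x (T x v)"
  note G_diff = metric_diff_left[OF ambient_metric]
  have Jv_norm: "gbar (f x) ?Jv ?Jv = real p * g x (T x v) v + real q * g x v v"
  proof -
    have "gbar (f x) ?Jv ?Jv = gbar (f x) (J (f x) ?Jv) (df x v)"
      by (rule structure_self_adjoint[symmetric])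
    then show ?thesis
      by (simp add: structure_square metric_add_left[OF ambient_metric] metric_scale_left[OF ambient_metric]
          tangential_part isometry)
  qed
  have pos: "gbar y u u \<ge> 0" for y u
    using metric_pos[OF ambient_metric, of u y] linear_0[OF metric_bilinear(2)[OF ambient_metric]]
    by (cases "u = 0") auto
  have T_pos: "g x (T x v) (T x v) \<ge> 0" using pos by (simp add: isometry[symmetric])
  have "?Jv \<noteq> 0"
  proof
    assume "?Jv = 0"
    then have "real q *\<^sub>R df x v = 0"
      using structure_square[of "f x" "df x v"] by (simp add: linear_0[OF structure_linear])
    then have "df x v = df x 0"
      using metallic by (simp add: metallic_riemannian_def linear_0[OF linear_dmap])
    then show False
      using isometric False by (auto simp: isometric_immersion_def dest: injD)
  qed
  then have J_pos: "gbar (f x) ?Jv ?Jv > 0" by (rule metric_pos[OF ambient_metric])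
  have "gbar (f x) ?w (df x (T x v)) = 0"
    by (simp add: G_diff tangential_part isometry)
  then have "gbar (f x) ?w ?w = gbar (f x) ?w ?Jv"
    by (simp only: linear_diff[OF metric_bilinear(1)[OF ambient_metric]] diff_zero)
  also have "\<dots> = gbar (f x) ?Jv ?Jv - gbar (f x) ?Jv (df x (T x v))"
    by (simp only: G_diff metric_bilinear(3)[OF ambient_metric, of "f x" "df x (T x v)" ?Jv])
  finally have "gbar (f x) ?w ?w = gbar (f x) ?Jv ?Jv - g x (T x v) (T x v)"
    by (simp only: tangential_part)
  then have le: "g x (T x v) (T x v) \<le> gbar (f x) ?Jv ?Jv"
    using pos[of "f x" ?w] by simp
  have "cos \<theta> = gnorm g x (T x v) / gnorm gbar (f x) ?Jv"
  proof -
    have "\<theta> = arccos (gnorm g x (T x v) / gnorm gbar (f x) ?Jv)"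
      using slant False by (simp add: slant_def slant_angle_at_def)
    moreover have "0 \<le> gnorm g x (T x v) / gnorm gbar (f x) ?Jv"
      using T_pos J_pos by (simp add: gnorm_def)
    moreover have "gnorm g x (T x v) / gnorm gbar (f x) ?Jv \<le> 1"
      using le J_pos by (simp add: gnorm_def)
    ultimately show ?thesis by (simp add: cos_arccos)
  qed
  then have "(cos \<theta>)\<^sup>2 = g x (T x v) (T x v) / gbar (f x) ?Jv ?Jv"
    using T_pos J_pos by (simp add: gnorm_def power_divide)
  then have "g x (T x v) (T x v) = (cos \<theta>)\<^sup>2 * gbar (f x) ?Jv ?Jv"
    using J_pos by simp
  then show ?thesis by (simp only: Jv_norm)
qed

text \<open>
  Both sides are self-adjoint, and their quadratic forms agree by the previous lemma; polarization does the rest.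
\<close>
lemma slant_T_square:
  assumes slant: "slant A B g gbar f J T \<theta>"
  shows "T x (T x u) = ((cos \<theta>)\<^sup>2 * real p) *\<^sub>R T x u + ((cos \<theta>)\<^sup>2 * real q) *\<^sub>R u"
proof (rule metric_eqI[OF metric, where x = x])
  fix z
  note lin = metric_add_left[OF metric] metric_scale_left[OF metric]
    linear_add[OF metric_bilinear(1)[OF metric]] linear_add[OF T_linear]
  have sym: "g x (T x z) (T x u) = g x (T x u) (T x z)" "g x z u = g x u z" "g x (T x z) u = g x (T x u) z"
    using metric_bilinear(3)[OF metric] T_self_adjoint by metis+
  have "2 * g x (T x u) (T x z) = 2 * ((cos \<theta>)\<^sup>2 * (real p * g x (T x u) z + real q * g x u z))"
    using slant_norm[OF slant, of x "u + z"] slant_norm[OF slant, of x u] slant_norm[OF slant, of x z]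
    by (simp add: lin sym algebra_simps)
  then show "g x (T x (T x u)) z = g x (((cos \<theta>)\<^sup>2 * real p) *\<^sub>R T x u + ((cos \<theta>)\<^sup>2 * real q) *\<^sub>R u) z"
    by (simp add: lin T_self_adjoint[of x "T x u"] algebra_simps)
qed

text \<open>
  By the previous lemma \<open>T\<^sup>2\<close> is a constant combination of \<open>T\<close> and the identity, which is parallel.
\<close>
lemma nabla_T_square:
  assumes slant: "slant A B g gbar f J T \<theta>"
    and W: "open W" "x \<in> W" and Y: "smooth_vf A W Y"
  shows "nabla_tensor D (\<lambda>y. T y \<circ> T y) X Y x = (real p * (cos \<theta>)\<^sup>2) *\<^sub>R nabla_tensor D T X Y x"
proof -
  interpret M: smooth_mapping A A "\<lambda>x. x" by (rule smooth_mapping_identity[OF atlas])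
  let ?c = "(cos \<theta>)\<^sup>2"
  have Y': "smooth_field_along A A (\<lambda>x. x) W Y" "smooth_field_along A A (\<lambda>x. x) W (\<lambda>y. T y (Y y))"
    using Y T_smooth[OF W(1) Y] by (simp_all add: smooth_vf_def)
  note const = M.smooth_field_along_scaleR[OF W(1) smooth_fun_const[OF atlas W(1)]]
  have "D x (X x) (\<lambda>y. (?c * real p) *\<^sub>R T y (Y y) + (?c * real q) *\<^sub>R Y y) =
      (?c * real p) *\<^sub>R D x (X x) (\<lambda>y. T y (Y y)) + (?c * real q) *\<^sub>R D x (X x) Y"
    by (simp add: M.connection_add[OF submanifold_connection W const[OF Y'(2)] const[OF Y'(1)]]
       M.connection_const_scaleR[OF submanifold_connection W Y'(1)]
       M.connection_const_scaleR[OF submanifold_connection W Y'(2)])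
  then show ?thesis
    by (simp add: nabla_tensor_def slant_T_square[OF slant] scaleR_diff_right mult.commute)
qed

lemma slant_right_angle_T_zero:
  assumes slant: "slant A B g gbar f J T \<theta>" and "cos \<theta> = 0"
  shows "T x v = 0"
proof (rule ccontr)
  assume "T x v \<noteq> 0"
  from metric_pos[OF metric this, of x] show False
    using slant_norm[OF slant, of x v] assms(2) by simp
qed

end

section \<open>Slant submanifolds with Codazzi square\<close>

theorem proposition3p25:
  fixes A :: "('m::{t2_space,second_countable_topology}, 'a::euclidean_space) chart set"
    and B :: "('n::{t2_space,second_countable_topology}, 'b::euclidean_space) chart set"
    and n r p q :: nat
    and g :: "'m \<Rightarrow> 'a \<Rightarrow> 'a \<Rightarrow> real" and gbar :: "'n \<Rightarrow> 'b \<Rightarrow> 'b \<Rightarrow> real"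
    and J :: "'n \<Rightarrow> 'b \<Rightarrow> 'b" and f :: "'m \<Rightarrow> 'n"
    and D :: "('m, 'a, 'a) connection" and Dbar :: "('n, 'b, 'b) connection"
    and Df :: "('m, 'a, 'b) connection"
    and U :: "'m set" and N :: "nat \<Rightarrow> 'm \<Rightarrow> 'b"
    and T :: "'m \<Rightarrow> 'a \<Rightarrow> 'a" and \<eta> :: "nat \<Rightarrow> 'm \<Rightarrow> 'a \<Rightarrow> real"
    and \<xi> :: "nat \<Rightarrow> 'm \<Rightarrow> 'a" and a :: "nat \<Rightarrow> nat \<Rightarrow> 'm \<Rightarrow> real"
    and h :: "nat \<Rightarrow> 'm \<Rightarrow> 'a \<Rightarrow> 'a \<Rightarrow> real" and AN :: "nat \<Rightarrow> 'm \<Rightarrow> 'a \<Rightarrow> 'a"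
    and \<theta> :: real
  assumes dims: "DIM('a) = n" "DIM('b) = n + r"
    and ambient: "locally_metallic B J gbar p q Dbar"
    and submanifold: "smooth_atlas A" "riemannian_metric A g" "isometric_immersion A B g gbar f"
    and connections: "levi_civita A g D" "pullback_connection A B f Dbar Df"
    and frame: "open U" "orthonormal_normal_frame A B gbar f U r N"
    and gauss: "second_fundamental_forms A B f D Df U r N h"
    and shape: "shape_operators g U r h AN"
    and induced: "induced_structure A B gbar f J U r N T \<eta> \<xi> a"
    and slant: "slant A B g gbar f J T \<theta>"
  shows "(\<forall>X Y. smooth_vf A UNIV X \<and> smooth_vf A UNIV Y \<longrightarrow>
            (\<forall>x\<in>U. nabla_tensor D (\<lambda>y. T y \<circ> T y) X Y x =
               (real p * (cos \<theta>)\<^sup>2) *\<^sub>R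
                 (\<Sum>\<alpha>=1..r. \<eta> \<alpha> x (Y x) *\<^sub>R AN \<alpha> x (X x) + h \<alpha> x (X x) (Y x) *\<^sub>R \<xi> \<alpha> x))) \<and>
         (codazzi A D (\<lambda>y. T y \<circ> T y) \<longrightarrow>
            (\<forall>X Y. smooth_vf A UNIV X \<and> smooth_vf A UNIV Y \<longrightarrow>
               (\<forall>x\<in>U. (\<Sum>\<alpha>=1..r. form_tensor (\<eta> \<alpha>) (AN \<alpha>) x (X x) (Y x)
                                  - tensor_form (AN \<alpha>) (\<eta> \<alpha>) x (X x) (Y x)) = 0)))"
proof -
  interpret metallic_submanifold A B r p q g gbar J f D Dbar Df U N T \<eta> \<xi> a h AN
    by (unfold_locales; fact)
  define S where "S X Y x = (\<Sum>\<alpha>=1..r. \<eta> \<alpha> x (Y x) *\<^sub>R AN \<alpha> x (X x) + h \<alpha> x (X x) (Y x) *\<^sub>R \<xi> \<alpha> x)"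
    for X Y x
  have nabla: "nabla_tensor D T X Y x = S X Y x"
    if "smooth_vf A UNIV X" "smooth_vf A UNIV Y" "x \<in> U" for X Y x
    unfolding S_def
    by (rule nabla_T[OF open_U subset_refl smooth_vf_subset[OF that(1) subset_UNIV]
          smooth_vf_subset[OF that(2) subset_UNIV] that(3)])
  have nabla2: "nabla_tensor D (\<lambda>y. T y \<circ> T y) X Y x = (real p * (cos \<theta>)\<^sup>2) *\<^sub>R S X Y x"
    if "smooth_vf A UNIV X" "smooth_vf A UNIV Y" "x \<in> U" for X Y x
    using nabla_T_square[OF slant open_UNIV UNIV_I that(2)] nabla[OF that] by simp
  have "(\<Sum>\<alpha>=1..r. form_tensor (\<eta> \<alpha>) (AN \<alpha>) x (X x) (Y x) - tensor_form (AN \<alpha>) (\<eta> \<alpha>) x (X x) (Y x)) = 0"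
    if cod: "codazzi A D (\<lambda>y. T y \<circ> T y)" and XY: "smooth_vf A UNIV X" "smooth_vf A UNIV Y"
      and x: "x \<in> U" for X Y x
  proof -
    \<comment> \<open>If the cosine vanishes the Codazzi condition is empty, but then so is T; otherwise its factor cancels.\<close>
    have "S X Y x = S Y X x"
    proof (cases "cos \<theta> = 0")
      case True
      have "nabla_tensor D T X Y x = 0" for X Y
        using smooth_mapping.connection_zero[OF smooth_mapping_identity[OF atlas] submanifold_connection]
        by (simp add: nabla_tensor_def slant_right_angle_T_zero[OF slant True])
      then show ?thesis using nabla[OF XY x] nabla[OF XY(2,1) x] by simp
    next
      case False
      have "(real p * (cos \<theta>)\<^sup>2) *\<^sub>R S X Y x = (real p * (cos \<theta>)\<^sup>2) *\<^sub>R S Y X x"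
        unfolding nabla2[OF XY x, symmetric] nabla2[OF XY(2,1) x, symmetric]
        using cod XY by (simp add: codazzi_def)
      moreover have "p > 0" using metallic by (simp add: metallic_riemannian_def)
      ultimately show ?thesis using False by simp
    qed
    then have "S Y X x - S X Y x = 0" by simp
    moreover have "S Y X x - S X Y x =
      (\<Sum>\<alpha>=1..r. form_tensor (\<eta> \<alpha>) (AN \<alpha>) x (X x) (Y x) - tensor_form (AN \<alpha>) (\<eta> \<alpha>) x (X x) (Y x))"
      unfolding S_def sum_subtractf[symmetric]
      by (intro sum.cong refl)
         (simp add: form_tensor_def tensor_form_def second_fundamental_form_symmetric[OF x, of _ "X x" "Y x"])
    ultimately show ?thesis by simp
  qed
  then show ?thesis
    using nabla2 unfolding S_def by (intro conjI impI allI ballI) simp_all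
qed

end
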